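(* Let $\mathcal A$ be a triangulated monoidal category and let $\mathbf E$ be a unital or counital idempotent in $\mathcal A$. Then $\mathbf E$ is characterized up to isomorphism (among idempotents of the same type, unital or counital) by any one of the following full subcategories of $\mathcal A$: (1) the full subcategory of objects $A\in\mathcal A$ such that $\mathbf E\otimes A\cong A$; (2) the full subcategory of objects $A\in\mathcal A$ such that $\mathbf E\otimes A\cong 0$; (3) the full subcategory of objects $A\in\mathcal A$ such that $A\otimes\mathbf E\cong A$; (4) the full subcategory of objects $A\in\mathcal A$ such that $A\otimes\mathbf E\cong 0$. That is, if $\mathbf E$ and $\mathbf E'$ are both unital (or both counital) idempotents and, for one of (1)--(4), the corresponding subcategories for $\mathbf E$ and $\mathbf E'$ coincide, then $\mathbf E\cong\mathbf E'$. In fact, if $(\mathbf C,\mathbf U)$ is a pair of complementary idempotents in $\mathcal A$, then the distinguished triangle $$\mathbf C\to\mathbb 1\to\mathbf U\to\mathbf C[1]$$ is uniquely determined by any of these subcategories (for $\mathbf E=\mathbf U$ or for $\mathbf E=\mathbf C$), up to unique isomorphism of triangles whose component at $\mathbb 1$ is $\mathrm{Id}_{\mathbb 1}$.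
   Context: A triangulated monoidal category is an additive category $\mathcal A$ equipped with: a triangulated structure (an invertible suspension endofunctor $[1]$ and a class of distinguished triangles satisfying the usual axioms, including Verdier's octahedral axiom); a monoidal structure $(\otimes,\mathbb 1)$ with left unitor $\lambda$; and natural isomorphisms $\alpha_A:A\otimes\mathbb 1[1]\to A[1]$ and $\beta_A:\mathbb 1[1]\otimes A\to A\otimes\mathbb 1[1]$ such that (suppressing associators) $\alpha_{\mathbb 1}=\lambda_{\mathbb 1[1]}$, $\alpha_{A[1]}\circ(\alpha_A\otimes\mathrm{Id}_{\mathbb 1[1]})=\alpha_A[1]\circ\alpha_{A\otimes\mathbb 1[1]}$, $\beta_{\mathbb 1[1]}=-\mathrm{Id}$, and $\beta_{A\otimes B}=(\mathrm{Id}_A\otimes\beta_B)\circ(\beta_A\otimes\mathrm{Id}_B)$. Further, for each distinguished triangle $A\to B\to C\to A[1]$ and each object $D$, the triangles $D\otimes A\to D\otimes B\to D\otimes C\to (D\otimes A)[1]$ and $A\otimes D\to B\otimes D\to C\otimes D\to (A\otimes D)[1]$ are distinguished, where the identifications $D\otimes A[1]\cong(D\otimes A)[1]$ and $A[1]\otimes D\cong(A\otimes D)[1]$ are built from $\alpha,\beta$ and the associator. A pair of complementary idempotents in $\mathcal A$ is a pair of objects $(\mathbf C,\mathbf U)$ with $\mathbf C\otimes\mathbf U\cong 0\cong\mathbf U\otimes\mathbf C$, together with a distinguished triangle $\mathbf C\xrightarrow{\varepsilon}\mathbb 1\xrightarrow{\eta}\mathbf U\xrightarrow{\delta}\mathbf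 C[1]$. In this case $(\mathbf U,\eta)$ is called a unital idempotent and $(\mathbf C,\varepsilon)$ a counital idempotent. Equivalently, $(\mathbf U,\eta:\mathbb 1\to\mathbf U)$ is a unital idempotent iff $\eta\otimes\mathrm{Id}_{\mathbf U}$ and $\mathrm{Id}_{\mathbf U}\otimes\eta$ are isomorphisms, and $(\mathbf C,\varepsilon:\mathbf C\to\mathbb 1)$ is a counital idempotent iff $\varepsilon\otimes\mathrm{Id}_{\mathbf C}$ and $\mathrm{Id}_{\mathbf C}\otimes\varepsilon$ are isomorphisms. *)

theory Defs
  imports Main "HOL-Algebra.Group"
begin

record ('o, 'a) category =
  Ob :: "'o set"
  Arr :: "'a set"
  Dom :: "'a \<Rightarrow> 'o"
  Cod :: "'a \<Rightarrow> 'o"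
  ident :: "'o \<Rightarrow> 'a"
  comp :: "'a \<Rightarrow> 'a \<Rightarrow> 'a" (infixl "\<cdot>\<index>" 65)

definition Hom :: "('o, 'a, 'x) category_scheme \<Rightarrow> 'o \<Rightarrow> 'o \<Rightarrow> 'a set"
  where "Hom \<C> A B = {f \<in> Arr \<C>. Dom \<C> f = A \<and> Cod \<C> f = B}"

text \<open>Composition \<open>g \<cdot> f\<close> is written in the usual order: first \<open>f\<close>, then \<open>g\<close>.\<close>

locale category =
  fixes \<C> :: "('o, 'a, 'x) category_scheme" (structure)
  assumes dom_cod: "f \<in> Arr \<C> \<Longrightarrow> Dom \<C> f \<in> Ob \<C> \<and> Cod \<C> f \<in> Ob \<C>"
    and ident_hom: "A \<in> Ob \<C> \<Longrightarrow> ident \<C> A \<in> Hom \<C> A A"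
    and comp_hom: "\<lbrakk>f \<in> Hom \<C> A B; g \<in> Hom \<C> B C\<rbrakk> \<Longrightarrow> g \<cdot> f \<in> Hom \<C> A C"
    and comp_ident: "f \<in> Hom \<C> A B \<Longrightarrow> f \<cdot> ident \<C> A = f"
    and ident_comp: "f \<in> Hom \<C> A B \<Longrightarrow> ident \<C> B \<cdot> f = f"
    and comp_assoc: "\<lbrakk>f \<in> Hom \<C> A B; g \<in> Hom \<C> B C; h \<in> Hom \<C> C D\<rbrakk>
      \<Longrightarrow> h \<cdot> (g \<cdot> f) = (h \<cdot> g) \<cdot> f"

definition inverse_arrows :: "('o, 'a, 'x) category_scheme \<Rightarrow> 'a \<Rightarrow> 'a \<Rightarrow> bool"
  where "inverse_arrows \<C> f g \<longleftrightarrow>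
    f \<in> Arr \<C> \<and> g \<in> Hom \<C> (Cod \<C> f) (Dom \<C> f) \<and>
    g \<cdot>\<^bsub>\<C>\<^esub> f = ident \<C> (Dom \<C> f) \<and> f \<cdot>\<^bsub>\<C>\<^esub> g = ident \<C> (Cod \<C> f)"

definition is_iso :: "('o, 'a, 'x) category_scheme \<Rightarrow> 'a \<Rightarrow> bool"
  where "is_iso \<C> f \<longleftrightarrow> (\<exists>g. inverse_arrows \<C> f g)"

definition inv_arr :: "('o, 'a, 'x) category_scheme \<Rightarrow> 'a \<Rightarrow> 'a"
  where "inv_arr \<C> f = (THE g. inverse_arrows \<C> f g)"

definition Iso :: "('o, 'a, 'x) category_scheme \<Rightarrow> 'o \<Rightarrow> 'o \<Rightarrow> 'a set"
  where "Iso \<C> A B = {f \<in> Hom \<C> A B. is_iso \<C> f}"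

definition isomorphic :: "('o, 'a, 'x) category_scheme \<Rightarrow> 'o \<Rightarrow> 'o \<Rightarrow> bool"
  where "isomorphic \<C> A B \<longleftrightarrow> Iso \<C> A B \<noteq> {}"

definition zero_object :: "('o, 'a, 'x) category_scheme \<Rightarrow> 'o \<Rightarrow> bool"
  where "zero_object \<C> Z \<longleftrightarrow> Z \<in> Ob \<C> \<and>
    (\<forall>A\<in>Ob \<C>. (\<exists>!f. f \<in> Hom \<C> Z A) \<and> (\<exists>!f. f \<in> Hom \<C> A Z))"

definition isomorphic_zero :: "('o, 'a, 'x) category_scheme \<Rightarrow> 'o \<Rightarrow> bool"
  where "isomorphic_zero \<C> A \<longleftrightarrow> (\<exists>Z. zero_object \<C> Z \<and> isomorphic \<C> A Z)"

definition full_subcategory ::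
    "('o, 'a, 'x) category_scheme \<Rightarrow> 'o set \<Rightarrow> ('o, 'a) category"
  where "full_subcategory \<C> S =
    \<lparr>Ob = S, Arr = {f \<in> Arr \<C>. Dom \<C> f \<in> S \<and> Cod \<C> f \<in> S},
     Dom = Dom \<C>, Cod = Cod \<C>, ident = ident \<C>, comp = comp \<C>\<rparr>"

definition endofunctor ::
    "('o, 'a, 'x) category_scheme \<Rightarrow> ('o \<Rightarrow> 'o) \<Rightarrow> ('a \<Rightarrow> 'a) \<Rightarrow> bool"
  where "endofunctor \<C> F\<^sub>o F\<^sub>a \<longleftrightarrow>
    (\<forall>A\<in>Ob \<C>. F\<^sub>o A \<in> Ob \<C> \<and> F\<^sub>a (ident \<C> A) = ident \<C> (F\<^sub>o A)) \<and>
    (\<forall>f\<in>Arr \<C>. F\<^sub>a f \<in> Hom \<C> (F\<^sub>o (Dom \<C> f)) (F\<^sub>o (Cod \<C> f))) \<and>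
    (\<forall>f\<in>Arr \<C>. \<forall>g\<in>Arr \<C>. Cod \<C> f = Dom \<C> g \<longrightarrow> F\<^sub>a (g \<cdot>\<^bsub>\<C>\<^esub> f) = F\<^sub>a g \<cdot>\<^bsub>\<C>\<^esub> F\<^sub>a f)"

text \<open>Invertible in the strict sense, i.e. an automorphism of the category.\<close>

definition invertible_endofunctor ::
    "('o, 'a, 'x) category_scheme \<Rightarrow> ('o \<Rightarrow> 'o) \<Rightarrow> ('a \<Rightarrow> 'a) \<Rightarrow> bool"
  where "invertible_endofunctor \<C> F\<^sub>o F\<^sub>a \<longleftrightarrow> endofunctor \<C> F\<^sub>o F\<^sub>a \<and>
    (\<exists>G\<^sub>o G\<^sub>a. endofunctor \<C> G\<^sub>o G\<^sub>a \<and>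
      (\<forall>A\<in>Ob \<C>. G\<^sub>o (F\<^sub>o A) = A \<and> F\<^sub>o (G\<^sub>o A) = A) \<and>
      (\<forall>f\<in>Arr \<C>. G\<^sub>a (F\<^sub>a f) = f \<and> F\<^sub>a (G\<^sub>a f) = f))"


record ('o, 'a) preadditive_category = "('o, 'a) category" +
  add :: "'a \<Rightarrow> 'a \<Rightarrow> 'a" (infixl "\<oplus>\<index>" 60)
  zero_arr :: "'o \<Rightarrow> 'o \<Rightarrow> 'a"

definition Hom_group :: "('o, 'a, 'x) preadditive_category_scheme \<Rightarrow> 'o \<Rightarrow> 'o \<Rightarrow> 'a monoid"
  where "Hom_group \<C> A B = \<lparr>carrier = Hom \<C> A B, mult = add \<C>, one = zero_arr \<C> A B\<rparr>"

definition neg :: "('o, 'a, 'x) preadditive_category_scheme \<Rightarrow> 'a \<Rightarrow> 'a" ("\<ominus>\<index> _" [81] 80)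
  where "\<ominus>\<^bsub>\<C>\<^esub> f = inv\<^bsub>Hom_group \<C> (Dom \<C> f) (Cod \<C> f)\<^esub> f"

locale additive_category = category \<C>
  for \<C> :: "('o, 'a, 'x) preadditive_category_scheme" (structure) +
  assumes hom_group: "\<lbrakk>A \<in> Ob \<C>; B \<in> Ob \<C>\<rbrakk> \<Longrightarrow> comm_group (Hom_group \<C> A B)"
    and comp_add: "\<lbrakk>f \<in> Hom \<C> A B; f' \<in> Hom \<C> A B; g \<in> Hom \<C> B C\<rbrakk>
      \<Longrightarrow> g \<cdot> (f \<oplus> f') = g \<cdot> f \<oplus> g \<cdot> f'"
    and add_comp: "\<lbrakk>f \<in> Hom \<C> A B; g \<in> Hom \<C> B C; g' \<in> Hom \<C> B C\<rbrakk>
      \<Longrightarrow> (g \<oplus> g') \<cdot> f = g \<cdot> f \<oplus> g' \<cdot> f"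
    and ex_zero_object: "\<exists>Z. zero_object \<C> Z"
    and ex_biproduct: "\<lbrakk>A \<in> Ob \<C>; B \<in> Ob \<C>\<rbrakk> \<Longrightarrow>
      \<exists>P\<in>Ob \<C>. \<exists>i\<in>Hom \<C> A P. \<exists>j\<in>Hom \<C> B P. \<exists>p\<in>Hom \<C> P A. \<exists>q\<in>Hom \<C> P B.
        p \<cdot> i = ident \<C> A \<and> q \<cdot> j = ident \<C> B \<and>
        p \<cdot> j = zero_arr \<C> B A \<and> q \<cdot> i = zero_arr \<C> A B \<and>
        i \<cdot> p \<oplus> j \<cdot> q = ident \<C> P"


text \<open>The suspension acts on objects by \<open>\<Sigma>\<close> and on arrows by \<open>\<sigma>\<close>.  A triangle is
  stored as its triple of arrows, which determine its objects.\<close>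

record ('o, 'a) triangulated_category = "('o, 'a) preadditive_category" +
  susp_ob :: "'o \<Rightarrow> 'o" ("\<Sigma>\<index>")
  susp_arr :: "'a \<Rightarrow> 'a" ("\<sigma>\<index>")
  Dist :: "('a \<times> 'a \<times> 'a) set"

definition triangle ::
    "('o, 'a, 'x) triangulated_category_scheme \<Rightarrow> 'a \<times> 'a \<times> 'a \<Rightarrow> bool"
  where "triangle \<C> = (\<lambda>(f, g, h). f \<in> Arr \<C> \<and> g \<in> Arr \<C> \<and> h \<in> Arr \<C> \<and>
    Cod \<C> f = Dom \<C> g \<and> Cod \<C> g = Dom \<C> h \<and> Cod \<C> h = \<Sigma>\<^bsub>\<C>\<^esub> (Dom \<C> f))"

definition triangle_morphism :: "('o, 'a, 'x) triangulated_category_scheme \<Rightarrow>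
    'a \<times> 'a \<times> 'a \<Rightarrow> 'a \<times> 'a \<times> 'a \<Rightarrow> 'a \<times> 'a \<times> 'a \<Rightarrow> bool"
  where "triangle_morphism \<C> = (\<lambda>(f, g, h) (f', g', h') (a, b, c).
    a \<in> Hom \<C> (Dom \<C> f) (Dom \<C> f') \<and>
    b \<in> Hom \<C> (Dom \<C> g) (Dom \<C> g') \<and>
    c \<in> Hom \<C> (Dom \<C> h) (Dom \<C> h') \<and>
    b \<cdot>\<^bsub>\<C>\<^esub> f = f' \<cdot>\<^bsub>\<C>\<^esub> a \<and>
    c \<cdot>\<^bsub>\<C>\<^esub> g = g' \<cdot>\<^bsub>\<C>\<^esub> b \<and>
    \<sigma>\<^bsub>\<C>\<^esub> a \<cdot>\<^bsub>\<C>\<^esub> h = h' \<cdot>\<^bsub>\<C>\<^esub> c)"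

definition triangle_iso :: "('o, 'a, 'x) triangulated_category_scheme \<Rightarrow>
    'a \<times> 'a \<times> 'a \<Rightarrow> 'a \<times> 'a \<times> 'a \<Rightarrow> 'a \<times> 'a \<times> 'a \<Rightarrow> bool"
  where "triangle_iso \<C> T T' = (\<lambda>(a, b, c).
    triangle_morphism \<C> T T' (a, b, c) \<and> is_iso \<C> a \<and> is_iso \<C> b \<and> is_iso \<C> c)"

locale triangulated_category = additive_category \<C>
  for \<C> :: "('o, 'a, 'x) triangulated_category_scheme" (structure) +
  assumes susp_invertible: "invertible_endofunctor \<C> \<Sigma> \<sigma>"
    and susp_add: "\<lbrakk>f \<in> Hom \<C> A B; g \<in> Hom \<C> A B\<rbrakk> \<Longrightarrow> \<sigma> (f \<oplus> g) = \<sigma> f \<oplus> \<sigma> g"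
    and dist_triangle: "T \<in> Dist \<C> \<Longrightarrow> triangle \<C> T"
    and dist_iso: "\<lbrakk>T \<in> Dist \<C>; triangle \<C> T'; triangle_iso \<C> T T' t\<rbrakk> \<Longrightarrow> T' \<in> Dist \<C>"
    and dist_ident: "\<lbrakk>A \<in> Ob \<C>; zero_object \<C> Z\<rbrakk>
      \<Longrightarrow> (ident \<C> A, zero_arr \<C> A Z, zero_arr \<C> Z (\<Sigma> A)) \<in> Dist \<C>"
    and dist_complete: "f \<in> Arr \<C> \<Longrightarrow> \<exists>g h. (f, g, h) \<in> Dist \<C>"
    and dist_rotate: "triangle \<C> (f, g, h) \<Longrightarrow> (f, g, h) \<in> Dist \<C> \<longleftrightarrow> (g, h, \<ominus> \<sigma> f) \<in> Dist \<C>"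
    and dist_fill: "\<lbrakk>(f, g, h) \<in> Dist \<C>; (f', g', h') \<in> Dist \<C>;
        a \<in> Hom \<C> (Dom \<C> f) (Dom \<C> f'); b \<in> Hom \<C> (Cod \<C> f) (Cod \<C> f'); b \<cdot> f = f' \<cdot> a\<rbrakk>
      \<Longrightarrow> \<exists>c. triangle_morphism \<C> (f, g, h) (f', g', h') (a, b, c)"
    and octahedral: "\<lbrakk>f \<in> Hom \<C> A B; g \<in> Hom \<C> B C;
        (f, u, v) \<in> Dist \<C>; (g, p, q) \<in> Dist \<C>; (g \<cdot> f, r, s) \<in> Dist \<C>\<rbrakk>
      \<Longrightarrow> \<exists>x\<in>Hom \<C> (Cod \<C> u) (Cod \<C> r). \<exists>y\<in>Hom \<C> (Cod \<C> r) (Cod \<C> p).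
        (x, y, \<sigma> u \<cdot> q) \<in> Dist \<C> \<and>
        x \<cdot> u = r \<cdot> g \<and> s \<cdot> x = v \<and> y \<cdot> r = p \<and> q \<cdot> y = \<sigma> f \<cdot> s"


text \<open>The tensor product is \<open>\<odot>\<close> on objects and \<open>\<boxtimes>\<close> on arrows, with unit object \<open>\<I>\<close>;
  \<open>assoc A B C\<close> goes from \<open>(A \<odot> B) \<odot> C\<close> to \<open>A \<odot> (B \<odot> C)\<close>.\<close>

record ('o, 'a) tm_category = "('o, 'a) triangulated_category" +
  tensor_ob :: "'o \<Rightarrow> 'o \<Rightarrow> 'o" (infixl "\<odot>\<index>" 75)
  tensor_arr :: "'a \<Rightarrow> 'a \<Rightarrow> 'a" (infixl "\<boxtimes>\<index>" 75)
  unit_ob :: "'o" ("\<I>\<index>")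
  assoc :: "'o \<Rightarrow> 'o \<Rightarrow> 'o \<Rightarrow> 'a"
  lunit :: "'o \<Rightarrow> 'a"
  runit :: "'o \<Rightarrow> 'a"
  susp_tensor :: "'o \<Rightarrow> 'a" ("\<alpha>\<index>")
  susp_braid :: "'o \<Rightarrow> 'a" ("\<beta>\<index>")

locale monoidal_category = category \<C>
  for \<C> :: "('o, 'a, 'x) tm_category_scheme" (structure) +
  assumes tensor_ob: "\<lbrakk>A \<in> Ob \<C>; B \<in> Ob \<C>\<rbrakk> \<Longrightarrow> A \<odot> B \<in> Ob \<C>"
    and tensor_hom: "\<lbrakk>f \<in> Hom \<C> A A'; g \<in> Hom \<C> B B'\<rbrakk> \<Longrightarrow> f \<boxtimes> g \<in> Hom \<C> (A \<odot> B) (A' \<odot> B')"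
    and tensor_ident: "\<lbrakk>A \<in> Ob \<C>; B \<in> Ob \<C>\<rbrakk>
      \<Longrightarrow> ident \<C> A \<boxtimes> ident \<C> B = ident \<C> (A \<odot> B)"
    and tensor_comp: "\<lbrakk>f \<in> Hom \<C> A A'; f' \<in> Hom \<C> A' A''; g \<in> Hom \<C> B B'; g' \<in> Hom \<C> B' B''\<rbrakk>
      \<Longrightarrow> (f' \<cdot> f) \<boxtimes> (g' \<cdot> g) = (f' \<boxtimes> g') \<cdot> (f \<boxtimes> g)"
    and unit_ob: "\<I> \<in> Ob \<C>"
    and assoc_iso: "\<lbrakk>A \<in> Ob \<C>; B \<in> Ob \<C>; C \<in> Ob \<C>\<rbrakk>
      \<Longrightarrow> assoc \<C> A B C \<in> Iso \<C> (A \<odot> B \<odot> C) (A \<odot> (B \<odot> C))"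
    and lunit_iso: "A \<in> Ob \<C> \<Longrightarrow> lunit \<C> A \<in> Iso \<C> (\<I> \<odot> A) A"
    and runit_iso: "A \<in> Ob \<C> \<Longrightarrow> runit \<C> A \<in> Iso \<C> (A \<odot> \<I>) A"
    and assoc_natural: "\<lbrakk>f \<in> Hom \<C> A A'; g \<in> Hom \<C> B B'; h \<in> Hom \<C> C C'\<rbrakk>
      \<Longrightarrow> assoc \<C> A' B' C' \<cdot> (f \<boxtimes> g \<boxtimes> h) = (f \<boxtimes> (g \<boxtimes> h)) \<cdot> assoc \<C> A B C"
    and lunit_natural: "f \<in> Hom \<C> A A' \<Longrightarrow> lunit \<C> A' \<cdot> (ident \<C> \<I> \<boxtimes> f) = f \<cdot> lunit \<C> A"
    and runit_natural: "f \<in> Hom \<C> A A' \<Longrightarrow> runit \<C> A' \<cdot> (f \<boxtimes> ident \<C> \<I>) = f \<cdot> runit \<C> A"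
    and pentagon: "\<lbrakk>A \<in> Ob \<C>; B \<in> Ob \<C>; C \<in> Ob \<C>; D \<in> Ob \<C>\<rbrakk> \<Longrightarrow>
      (ident \<C> A \<boxtimes> assoc \<C> B C D) \<cdot> assoc \<C> A (B \<odot> C) D \<cdot> (assoc \<C> A B C \<boxtimes> ident \<C> D)
        = assoc \<C> A B (C \<odot> D) \<cdot> assoc \<C> (A \<odot> B) C D"
    and unit_triangle: "\<lbrakk>A \<in> Ob \<C>; B \<in> Ob \<C>\<rbrakk> \<Longrightarrow>
      (ident \<C> A \<boxtimes> lunit \<C> B) \<cdot> assoc \<C> A \<I> B = runit \<C> A \<boxtimes> ident \<C> B"

text \<open>The identifications of \<open>D \<odot> \<Sigma> A\<close> with \<open>\<Sigma> (D \<odot> A)\<close> and of \<open>\<Sigma> A \<odot> D\<close> with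
  \<open>\<Sigma> (A \<odot> D)\<close>: desuspend \<open>\<Sigma> A\<close> to \<open>A \<odot> \<Sigma> \<I>\<close> by the inverse of \<open>\<alpha>\<close>, move \<open>\<Sigma> \<I>\<close> to the
  far right (by \<open>\<beta>\<close> in the second case), and apply \<open>\<alpha>\<close>.\<close>

definition susp_out_left :: "('o, 'a, 'x) tm_category_scheme \<Rightarrow> 'o \<Rightarrow> 'o \<Rightarrow> 'a"
  where "susp_out_left \<C> D A = (let S = \<Sigma>\<^bsub>\<C>\<^esub> \<I>\<^bsub>\<C>\<^esub> in
    \<alpha>\<^bsub>\<C>\<^esub> (D \<odot>\<^bsub>\<C>\<^esub> A)
    \<cdot>\<^bsub>\<C>\<^esub> inv_arr \<C> (assoc \<C> D A S)
    \<cdot>\<^bsub>\<C>\<^esub> (ident \<C> D \<boxtimes>\<^bsub>\<C>\<^esub> inv_arr \<C> (\<alpha>\<^bsub>\<C>\<^esub> A)))"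

definition susp_out_right :: "('o, 'a, 'x) tm_category_scheme \<Rightarrow> 'o \<Rightarrow> 'o \<Rightarrow> 'a"
  where "susp_out_right \<C> A D = (let S = \<Sigma>\<^bsub>\<C>\<^esub> \<I>\<^bsub>\<C>\<^esub> in
    \<alpha>\<^bsub>\<C>\<^esub> (A \<odot>\<^bsub>\<C>\<^esub> D)
    \<cdot>\<^bsub>\<C>\<^esub> inv_arr \<C> (assoc \<C> A D S)
    \<cdot>\<^bsub>\<C>\<^esub> (ident \<C> A \<boxtimes>\<^bsub>\<C>\<^esub> \<beta>\<^bsub>\<C>\<^esub> D)
    \<cdot>\<^bsub>\<C>\<^esub> assoc \<C> A S D
    \<cdot>\<^bsub>\<C>\<^esub> (inv_arr \<C> (\<alpha>\<^bsub>\<C>\<^esub> A) \<boxtimes>\<^bsub>\<C>\<^esub> ident \<C> D))"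

locale triangulated_monoidal_category = triangulated_category \<C> + monoidal_category \<C>
  for \<C> :: "('o, 'a, 'x) tm_category_scheme" (structure) +
  assumes alpha_iso: "A \<in> Ob \<C> \<Longrightarrow> \<alpha> A \<in> Iso \<C> (A \<odot> \<Sigma> \<I>) (\<Sigma> A)"
    and alpha_natural: "f \<in> Hom \<C> A B \<Longrightarrow> \<alpha> B \<cdot> (f \<boxtimes> ident \<C> (\<Sigma> \<I>)) = \<sigma> f \<cdot> \<alpha> A"
    and beta_iso: "A \<in> Ob \<C> \<Longrightarrow> \<beta> A \<in> Iso \<C> (\<Sigma> \<I> \<odot> A) (A \<odot> \<Sigma> \<I>)"
    and beta_natural: "f \<in> Hom \<C> A B
      \<Longrightarrow> \<beta> B \<cdot> (ident \<C> (\<Sigma> \<I>) \<boxtimes> f) = (f \<boxtimes> ident \<C> (\<Sigma> \<I>)) \<cdot> \<beta> A"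
    and alpha_unit: "\<alpha> \<I> = lunit \<C> (\<Sigma> \<I>)"
    and alpha_susp: "A \<in> Ob \<C>
      \<Longrightarrow> \<alpha> (\<Sigma> A) \<cdot> (\<alpha> A \<boxtimes> ident \<C> (\<Sigma> \<I>)) = \<sigma> (\<alpha> A) \<cdot> \<alpha> (A \<odot> \<Sigma> \<I>)"
    and beta_susp_unit: "\<beta> (\<Sigma> \<I>) = \<ominus> ident \<C> (\<Sigma> \<I> \<odot> \<Sigma> \<I>)"
    and beta_tensor: "\<lbrakk>A \<in> Ob \<C>; B \<in> Ob \<C>\<rbrakk> \<Longrightarrow>
      \<beta> (A \<odot> B) = inv_arr \<C> (assoc \<C> A B (\<Sigma> \<I>)) \<cdot> (ident \<C> A \<boxtimes> \<beta> B)
        \<cdot> assoc \<C> A (\<Sigma> \<I>) B \<cdot> (\<beta> A \<boxtimes> ident \<C> B) \<cdot> inv_arr \<C> (assoc \<C> (\<Sigma> \<I>) A B)"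
    and tensor_dist_left: "\<lbrakk>(f, g, h) \<in> Dist \<C>; D \<in> Ob \<C>\<rbrakk> \<Longrightarrow>
      (ident \<C> D \<boxtimes> f, ident \<C> D \<boxtimes> g,
       susp_out_left \<C> D (Dom \<C> f) \<cdot> (ident \<C> D \<boxtimes> h)) \<in> Dist \<C>"
    and tensor_dist_right: "\<lbrakk>(f, g, h) \<in> Dist \<C>; D \<in> Ob \<C>\<rbrakk> \<Longrightarrow>
      (f \<boxtimes> ident \<C> D, g \<boxtimes> ident \<C> D,
       susp_out_right \<C> (Dom \<C> f) D \<cdot> (h \<boxtimes> ident \<C> D)) \<in> Dist \<C>"


definition complementary_idempotents ::
    "('o, 'a, 'x) tm_category_scheme \<Rightarrow> 'o \<Rightarrow> 'o \<Rightarrow> 'a \<Rightarrow> 'a \<Rightarrow> 'a \<Rightarrow> bool"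
  where "complementary_idempotents \<A> C U \<epsilon> \<eta> \<delta> \<longleftrightarrow>
    C \<in> Ob \<A> \<and> U \<in> Ob \<A> \<and>
    isomorphic_zero \<A> (C \<odot>\<^bsub>\<A>\<^esub> U) \<and> isomorphic_zero \<A> (U \<odot>\<^bsub>\<A>\<^esub> C) \<and>
    \<epsilon> \<in> Hom \<A> C \<I>\<^bsub>\<A>\<^esub> \<and> \<eta> \<in> Hom \<A> \<I>\<^bsub>\<A>\<^esub> U \<and> \<delta> \<in> Hom \<A> U (\<Sigma>\<^bsub>\<A>\<^esub> C) \<and>
    (\<epsilon>, \<eta>, \<delta>) \<in> Dist \<A>"

definition unital_idempotent :: "('o, 'a, 'x) tm_category_scheme \<Rightarrow> 'o \<Rightarrow> 'a \<Rightarrow> bool"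
  where "unital_idempotent \<A> U \<eta> \<longleftrightarrow> (\<exists>C \<epsilon> \<delta>. complementary_idempotents \<A> C U \<epsilon> \<eta> \<delta>)"

definition counital_idempotent :: "('o, 'a, 'x) tm_category_scheme \<Rightarrow> 'o \<Rightarrow> 'a \<Rightarrow> bool"
  where "counital_idempotent \<A> C \<epsilon> \<longleftrightarrow> (\<exists>U \<eta> \<delta>. complementary_idempotents \<A> C U \<epsilon> \<eta> \<delta>)"

definition left_fixed :: "('o, 'a, 'x) tm_category_scheme \<Rightarrow> 'o \<Rightarrow> ('o, 'a) category"
  where "left_fixed \<A> E = full_subcategory \<A> {A \<in> Ob \<A>. isomorphic \<A> (E \<odot>\<^bsub>\<A>\<^esub> A) A}"

definition left_killed :: "('o, 'a, 'x) tm_category_scheme \<Rightarrow> 'o \<Rightarrow> ('o, 'a) category"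
  where "left_killed \<A> E = full_subcategory \<A> {A \<in> Ob \<A>. isomorphic_zero \<A> (E \<odot>\<^bsub>\<A>\<^esub> A)}"

definition right_fixed :: "('o, 'a, 'x) tm_category_scheme \<Rightarrow> 'o \<Rightarrow> ('o, 'a) category"
  where "right_fixed \<A> E = full_subcategory \<A> {A \<in> Ob \<A>. isomorphic \<A> (A \<odot>\<^bsub>\<A>\<^esub> E) A}"

definition right_killed :: "('o, 'a, 'x) tm_category_scheme \<Rightarrow> 'o \<Rightarrow> ('o, 'a) category"
  where "right_killed \<A> E = full_subcategory \<A> {A \<in> Ob \<A>. isomorphic_zero \<A> (A \<odot>\<^bsub>\<A>\<^esub> E)}"

end

(* If C -> 1 -> U -> C[1] is the triangle of a pair of complementary idempotents, then tensoring it
   with A shows that A is killed by U iff A is fixed by C, and killed by C iff fixed by U; so each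
   coincidence of subcategories for (C, U) and (C', U') is a coincidence of objects killed by C and
   C' or by U and U'.  If U kills X and C kills Y, naturality of C \<odot> X -> X, an isomorphism,
   gives Hom(X, Y) = 0.  A coincidence therefore forces Hom(C, U') = 0 = Hom(C[1], U') and likewise
   with primes exchanged.  The first vanishing yields a morphism of triangles over the identity of
   the unit, the second its uniqueness; composing the two morphisms between the triangles gives
   inverse isomorphisms. *)

theory Submission
  imports Defs
begin

text \<open>The fixed subcategories ask only for some isomorphism between \<open>E \<odot> A\<close>
  and \<open>A\<close>, not for invertibility of the canonical map. An arbitrary isomorphism is
  still enough: tensoring it with the complementary idempotent shows that the complement kills
  \<open>A\<close>, and the triangle then makes the canonical map invertible.

  Cones are not functorial, so two vanishings enter. Hom(C, U') = 0 lifts the counit of C through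
  that of C', and the filling axiom adds a third component without making it unique; Hom(C[1], U') =
  0 makes both outer components unique. It holds for the same reason as the first, because the
  objects killed by U are closed under suspension; if the suspended object is the left tensor
  factor, this closure rests on \<open>\<beta>\<close>. Identifying the two composites with
  identities also needs the vanishing inside one triangle, from C and C[1] to U, which is the
  comparison of a pair with itself.

  The axioms do not state that the tensor product is additive on arrows, so even the preservation of
  zero objects has to be drawn from its exactness.\<close>

section \<open>Isomorphisms\<close>

context category
begin

lemma HomD:
  assumes "f \<in> Hom \<C> A B"
  shows "f \<in> Arr \<C>" "Dom \<C> f = A" "Cod \<C> f = B" "A \<in> Ob \<C>" "B \<in> Ob \<C>"
  using assms dom_cod unfolding Hom_def by auto

lemma IsoI:
  assumes "f \<in> Hom \<C> A B" "g \<in> Hom \<C> B A" "g \<cdot> f = ident \<C> A" "f \<cdot> g = ident \<C> B"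
  shows "f \<in> Iso \<C> A B"
  using assms HomD[OF assms(1)] unfolding Iso_def is_iso_def inverse_arrows_def by auto

lemma IsoE:
  assumes "f \<in> Iso \<C> A B"
  obtains g where "f \<in> Hom \<C> A B" "g \<in> Hom \<C> B A" "g \<cdot> f = ident \<C> A" "f \<cdot> g = ident \<C> B"
  using assms unfolding Iso_def is_iso_def inverse_arrows_def Hom_def by auto

lemma ident_Iso: "A \<in> Ob \<C> \<Longrightarrow> ident \<C> A \<in> Iso \<C> A A"
  by (rule IsoI) (auto intro: ident_hom comp_ident)

lemma isomorphic_refl: "A \<in> Ob \<C> \<Longrightarrow> isomorphic \<C> A A"
  using ident_Iso unfolding isomorphic_def by blast

lemma isomorphicI: "f \<in> Iso \<C> A B \<Longrightarrow> isomorphic \<C> A B"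
  unfolding isomorphic_def by blast

lemma isomorphicE:
  assumes "isomorphic \<C> A B"
  obtains f g where "f \<in> Hom \<C> A B" "g \<in> Hom \<C> B A" "g \<cdot> f = ident \<C> A" "f \<cdot> g = ident \<C> B"
  using assms unfolding isomorphic_def by (metis IsoE ex_in_conv)

lemma isomorphic_sym: "isomorphic \<C> A B \<Longrightarrow> isomorphic \<C> B A"
  by (elim isomorphicE) (blast intro: isomorphicI IsoI)

lemma endofunctor_hom:
  assumes "endofunctor \<C> F\<^sub>o F\<^sub>a" "f \<in> Hom \<C> A B"
  shows "F\<^sub>a f \<in> Hom \<C> (F\<^sub>o A) (F\<^sub>o B)"
  using assms HomD[OF assms(2)] unfolding endofunctor_def by auto

lemma endofunctor_comp:
  assumes "endofunctor \<C> F\<^sub>o F\<^sub>a" "f \<in> Hom \<C> A B" "g \<in> Hom \<C> B D"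
  shows "F\<^sub>a (g \<cdot> f) = F\<^sub>a g \<cdot> F\<^sub>a f"
  using assms HomD[OF assms(2)] HomD[OF assms(3)] unfolding endofunctor_def by auto

lemma endofunctorI:
  assumes "\<And>A. A \<in> Ob \<C> \<Longrightarrow> F\<^sub>o A \<in> Ob \<C>"
    and "\<And>A. A \<in> Ob \<C> \<Longrightarrow> F\<^sub>a (ident \<C> A) = ident \<C> (F\<^sub>o A)"
    and "\<And>f A B. f \<in> Hom \<C> A B \<Longrightarrow> F\<^sub>a f \<in> Hom \<C> (F\<^sub>o A) (F\<^sub>o B)"
    and "\<And>f g A B D. \<lbrakk>f \<in> Hom \<C> A B; g \<in> Hom \<C> B D\<rbrakk> \<Longrightarrow> F\<^sub>a (g \<cdot> f) = F\<^sub>a g \<cdot> F\<^sub>a f"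
  shows "endofunctor \<C> F\<^sub>o F\<^sub>a"
  using assms unfolding endofunctor_def Hom_def by blast

lemma endofunctor_isomorphic:
  assumes F: "endofunctor \<C> F\<^sub>o F\<^sub>a" and "isomorphic \<C> A B"
  shows "isomorphic \<C> (F\<^sub>o A) (F\<^sub>o B)"
proof -
  from assms(2) obtain f g where f: "f \<in> Hom \<C> A B" and g: "g \<in> Hom \<C> B A"
    and gf: "g \<cdot> f = ident \<C> A" "f \<cdot> g = ident \<C> B" by (rule isomorphicE)
  have "F\<^sub>a g \<cdot> F\<^sub>a f = ident \<C> (F\<^sub>o A)" "F\<^sub>a f \<cdot> F\<^sub>a g = ident \<C> (F\<^sub>o B)"
    using endofunctor_comp[OF F f g] endofunctor_comp[OF F g f] gf F HomD[OF f]
    unfolding endofunctor_def by auto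
  then show ?thesis
    using IsoI endofunctor_hom[OF F f] endofunctor_hom[OF F g] isomorphicI by blast
qed

end

section \<open>Zero arrows and zero objects\<close>

context additive_category
begin

lemma zero_hom: "\<lbrakk>A \<in> Ob \<C>; B \<in> Ob \<C>\<rbrakk> \<Longrightarrow> zero_arr \<C> A B \<in> Hom \<C> A B"
  using monoid.one_closed[of "Hom_group \<C> A B"] hom_group[of A B]
  unfolding comm_group_def group_def by (simp add: Hom_group_def)

lemma add_zero: "f \<in> Hom \<C> A B \<Longrightarrow> f \<oplus> zero_arr \<C> A B = f"
  using monoid.r_one[of "Hom_group \<C> A B" f] hom_group[of A B] HomD[of f A B]
  unfolding comm_group_def group_def by (simp add: Hom_group_def)

lemma add_eq_self:
  assumes "f \<in> Hom \<C> A B" "g \<in> Hom \<C> A B" "f \<oplus> g = f"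
  shows "g = zero_arr \<C> A B"
proof -
  interpret G: comm_group "Hom_group \<C> A B" using hom_group HomD[OF assms(1)] by blast
  show ?thesis using G.l_cancel_one[of f g] assms by (simp add: Hom_group_def)
qed

lemma diffE:
  assumes "f \<in> Hom \<C> A B" "g \<in> Hom \<C> A B"
  obtains d where "d \<in> Hom \<C> A B" "f = g \<oplus> d"
proof -
  interpret G: comm_group "Hom_group \<C> A B" using hom_group HomD[OF assms(1)] by blast
  let ?d = "inv\<^bsub>Hom_group \<C> A B\<^esub> g \<otimes>\<^bsub>Hom_group \<C> A B\<^esub> f"
  have fg: "f \<in> carrier (Hom_group \<C> A B)" "g \<in> carrier (Hom_group \<C> A B)"
    using assms by (simp_all add: Hom_group_def)
  have d: "?d \<in> carrier (Hom_group \<C> A B)" using fg by blast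
  have "g \<otimes>\<^bsub>Hom_group \<C> A B\<^esub> ?d = f"
    using fg G.m_assoc[of g "inv\<^bsub>Hom_group \<C> A B\<^esub> g" f] by (metis G.inv_closed G.r_inv G.l_one)
  with d show ?thesis using that[of ?d] by (simp add: Hom_group_def)
qed

lemma comp_zero:
  assumes "g \<in> Hom \<C> B D" "A \<in> Ob \<C>"
  shows "g \<cdot> zero_arr \<C> A B = zero_arr \<C> A D"
proof -
  have z: "zero_arr \<C> A B \<in> Hom \<C> A B" using zero_hom HomD[OF assms(1)] assms(2) by blast
  have "g \<cdot> zero_arr \<C> A B \<oplus> g \<cdot> zero_arr \<C> A B = g \<cdot> zero_arr \<C> A B"
    using comp_add[OF z z assms(1)] add_zero[OF z] by simp
  then show ?thesis using add_eq_self comp_hom[OF z assms(1)] by blast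
qed

lemma zero_comp:
  assumes "f \<in> Hom \<C> A B" "D \<in> Ob \<C>"
  shows "zero_arr \<C> B D \<cdot> f = zero_arr \<C> A D"
proof -
  have z: "zero_arr \<C> B D \<in> Hom \<C> B D" using zero_hom HomD[OF assms(1)] assms(2) by blast
  have "zero_arr \<C> B D \<cdot> f \<oplus> zero_arr \<C> B D \<cdot> f = zero_arr \<C> B D \<cdot> f"
    using add_comp[OF assms(1) z z] add_zero[OF z] by simp
  then show ?thesis using add_eq_self comp_hom[OF assms(1) z] by blast
qed

text \<open>Additivity turns cancellation into a kernel computation. Only arrows from the single
  object \<open>X\<close> are tested, since the vanishing of individual Hom groups controls no more
  than that.\<close>

lemma monicI:
  assumes f: "f \<in> Hom \<C> A B" and c: "c \<in> Hom \<C> X A" and c': "c' \<in> Hom \<C> X A"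
    and eq: "f \<cdot> c = f \<cdot> c'"
    and ker: "\<And>d. \<lbrakk>d \<in> Hom \<C> X A; f \<cdot> d = zero_arr \<C> X B\<rbrakk> \<Longrightarrow> d = zero_arr \<C> X A"
  shows "c = c'"
proof -
  obtain d where d: "d \<in> Hom \<C> X A" "c = c' \<oplus> d" using diffE[OF c c'] .
  have "f \<cdot> c' \<oplus> f \<cdot> d = f \<cdot> c'" using comp_add[OF c' d(1) f] d(2) eq by simp
  then have "f \<cdot> d = zero_arr \<C> X B"
    using add_eq_self comp_hom[OF c' f] comp_hom[OF d(1) f] by blast
  then show ?thesis using ker[OF d(1)] d(2) add_zero[OF c'] by simp
qed

lemma epicI:
  assumes f: "f \<in> Hom \<C> A B" and c: "c \<in> Hom \<C> B X" and c': "c' \<in> Hom \<C> B X"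
    and eq: "c \<cdot> f = c' \<cdot> f"
    and ker: "\<And>d. \<lbrakk>d \<in> Hom \<C> B X; d \<cdot> f = zero_arr \<C> A X\<rbrakk> \<Longrightarrow> d = zero_arr \<C> B X"
  shows "c = c'"
proof -
  obtain d where d: "d \<in> Hom \<C> B X" "c = c' \<oplus> d" using diffE[OF c c'] .
  have "c' \<cdot> f \<oplus> d \<cdot> f = c' \<cdot> f" using add_comp[OF f c' d(1)] d(2) eq by simp
  then have "d \<cdot> f = zero_arr \<C> A X"
    using add_eq_self comp_hom[OF f c'] comp_hom[OF f d(1)] by blast
  then show ?thesis using ker[OF d(1)] d(2) add_zero[OF c'] by simp
qed

lemma neg_hom:
  assumes "f \<in> Hom \<C> A B"
  shows "\<ominus> f \<in> Hom \<C> A B" and "f \<oplus> \<ominus> f = zero_arr \<C> A B"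
proof -
  interpret G: comm_group "Hom_group \<C> A B" using hom_group HomD[OF assms(1)] by blast
  show "\<ominus> f \<in> Hom \<C> A B" "f \<oplus> \<ominus> f = zero_arr \<C> A B"
    using G.inv_closed[of f] G.r_inv[of f] assms HomD[OF assms]
    by (simp_all add: neg_def Hom_group_def)
qed

lemma neg_eqI:
  assumes "f \<in> Hom \<C> A B" "g \<in> Hom \<C> A B" "f \<oplus> g = zero_arr \<C> A B"
  shows "g = \<ominus> f"
proof -
  interpret G: comm_group "Hom_group \<C> A B" using hom_group HomD[OF assms(1)] by blast
  show ?thesis
    using G.inv_unique'[of f g] G.m_comm[of f g] assms HomD[OF assms(1)]
    by (simp add: neg_def Hom_group_def)
qed

lemma neg_inject:
  assumes "f \<in> Hom \<C> A B" "g \<in> Hom \<C> A B" "\<ominus> f = \<ominus> g"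
  shows "f = g"
proof -
  interpret G: comm_group "Hom_group \<C> A B" using hom_group HomD[OF assms(1)] by blast
  have "inv\<^bsub>Hom_group \<C> A B\<^esub> f = inv\<^bsub>Hom_group \<C> A B\<^esub> g"
    using assms(3) HomD(2,3)[OF assms(1)] HomD(2,3)[OF assms(2)] unfolding neg_def by simp
  moreover have "f \<in> carrier (Hom_group \<C> A B)" "g \<in> carrier (Hom_group \<C> A B)"
    using assms by (simp_all add: Hom_group_def)
  ultimately show ?thesis by (metis G.inv_inv)
qed

lemma neg_zero: "\<lbrakk>A \<in> Ob \<C>; B \<in> Ob \<C>\<rbrakk> \<Longrightarrow> \<ominus> zero_arr \<C> A B = zero_arr \<C> A B"
  using neg_eqI zero_hom add_zero by metis

lemma comp_neg:
  assumes "f \<in> Hom \<C> A B" "g \<in> Hom \<C> B D"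
  shows "g \<cdot> \<ominus> f = \<ominus> (g \<cdot> f)"
  using assms neg_hom[OF assms(1)] comp_add[of f A B "\<ominus> f" g D] comp_zero[of g B D A] HomD[OF assms(1)]
  by (intro neg_eqI[of _ A D]) (auto intro: comp_hom)

lemma neg_comp:
  assumes "f \<in> Hom \<C> A B" "g \<in> Hom \<C> B D"
  shows "\<ominus> g \<cdot> f = \<ominus> (g \<cdot> f)"
  using assms neg_hom[OF assms(2)] add_comp[of f A B g D "\<ominus> g"] zero_comp[of f A B D] HomD[OF assms(2)]
  by (intro neg_eqI[of _ A D]) (auto intro: comp_hom)

text \<open>Makes vanishing of an object an equation between arrows: every arrow into or out of
  \<open>A\<close> factors through its identity, so this one equation settles them all.\<close>

lemma isomorphic_zero_iff:
  "isomorphic_zero \<C> A \<longleftrightarrow> A \<in> Ob \<C> \<and> ident \<C> A = zero_arr \<C> A A"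
proof
  assume "isomorphic_zero \<C> A"
  then obtain Z where Z: "zero_object \<C> Z" and iso: "isomorphic \<C> A Z"
    unfolding isomorphic_zero_def by blast
  from iso obtain f g where f: "f \<in> Hom \<C> A Z" and g: "g \<in> Hom \<C> Z A" and gf: "g \<cdot> f = ident \<C> A"
    by (rule isomorphicE)
  have A: "A \<in> Ob \<C>" "Z \<in> Ob \<C>" using HomD[OF f] by auto
  then have "f = zero_arr \<C> A Z" using Z f zero_hom unfolding zero_object_def by blast
  then show "A \<in> Ob \<C> \<and> ident \<C> A = zero_arr \<C> A A" using gf comp_zero[OF g A(1)] A by simp
next
  assume A: "A \<in> Ob \<C> \<and> ident \<C> A = zero_arr \<C> A A"
  have "\<exists>!f. f \<in> Hom \<C> A B" "\<exists>!f. f \<in> Hom \<C> B A" if B: "B \<in> Ob \<C>" for B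
  proof -
    have "f = zero_arr \<C> A B" if "f \<in> Hom \<C> A B" for f
      using comp_ident[OF that] comp_zero[OF that] A by simp
    then show "\<exists>!f. f \<in> Hom \<C> A B" using zero_hom A B by blast
    have "f = zero_arr \<C> B A" if "f \<in> Hom \<C> B A" for f
      using ident_comp[OF that] zero_comp[OF that] A by simp
    then show "\<exists>!f. f \<in> Hom \<C> B A" using zero_hom A B by blast
  qed
  then have "zero_object \<C> A" using A unfolding zero_object_def by blast
  then show "isomorphic_zero \<C> A" using isomorphic_refl A unfolding isomorphic_zero_def by blast
qed

lemma isomorphic_zero_Ob: "isomorphic_zero \<C> A \<Longrightarrow> A \<in> Ob \<C>"
  by (simp add: isomorphic_zero_iff)

lemma to_isomorphic_zero:
  assumes "isomorphic_zero \<C> B" "f \<in> Hom \<C> A B" shows "f = zero_arr \<C> A B"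
  using assms ident_comp[OF assms(2)] zero_comp[OF assms(2)] by (simp add: isomorphic_zero_iff)

lemma from_isomorphic_zero:
  assumes "isomorphic_zero \<C> A" "f \<in> Hom \<C> A B" shows "f = zero_arr \<C> A B"
  using assms comp_ident[OF assms(2)] comp_zero[OF assms(2)] by (simp add: isomorphic_zero_iff)

lemma zero_object_imp_isomorphic_zero: "zero_object \<C> Z \<Longrightarrow> isomorphic_zero \<C> Z"
  using isomorphic_refl unfolding isomorphic_zero_def zero_object_def by blast

lemma isomorphic_zero_imp_zero_object: "isomorphic_zero \<C> A \<Longrightarrow> zero_object \<C> A"
  using to_isomorphic_zero from_isomorphic_zero zero_hom isomorphic_zero_Ob
  unfolding zero_object_def by metis

lemma isomorphic_zero_cong:
  assumes "isomorphic \<C> A B" "isomorphic_zero \<C> B"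
  shows "isomorphic_zero \<C> A"
proof -
  from assms(1) obtain f g where f: "f \<in> Hom \<C> A B" and g: "g \<in> Hom \<C> B A"
    and gf: "g \<cdot> f = ident \<C> A" by (rule isomorphicE)
  have "f = zero_arr \<C> A B" using to_isomorphic_zero assms(2) f by blast
  then show ?thesis using gf comp_zero[OF g] HomD[OF f] by (simp add: isomorphic_zero_iff)
qed

end

section \<open>Distinguished triangles\<close>

context triangulated_category
begin

section \<open>The suspension as an additive automorphism\<close>

lemma susp_endofunctor: "endofunctor \<C> \<Sigma> \<sigma>"
  using susp_invertible unfolding invertible_endofunctor_def by blast

lemma susp_Ob: "A \<in> Ob \<C> \<Longrightarrow> \<Sigma> A \<in> Ob \<C>"
  using susp_endofunctor unfolding endofunctor_def by blast

lemma susp_hom: "f \<in> Hom \<C> A B \<Longrightarrow> \<sigma> f \<in> Hom \<C> (\<Sigma> A) (\<Sigma> B)"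
  using endofunctor_hom[OF susp_endofunctor] .

lemma susp_ident: "A \<in> Ob \<C> \<Longrightarrow> \<sigma> (ident \<C> A) = ident \<C> (\<Sigma> A)"
  using susp_endofunctor unfolding endofunctor_def by blast

text \<open>The inverse of the suspension is strict, so it sends \<open>\<Sigma> A\<close> and
  \<open>\<Sigma> B\<close> back to \<open>A\<close> and \<open>B\<close> themselves and its value
  at \<open>c\<close> is the preimage.\<close>

lemma susp_full:
  assumes "c \<in> Hom \<C> (\<Sigma> A) (\<Sigma> B)" "A \<in> Ob \<C>" "B \<in> Ob \<C>"
  obtains d where "d \<in> Hom \<C> A B" "\<sigma> d = c"
proof -
  obtain G\<^sub>o G\<^sub>a where G: "endofunctor \<C> G\<^sub>o G\<^sub>a" "\<forall>A\<in>Ob \<C>. G\<^sub>o (\<Sigma> A) = A" "\<forall>f\<in>Arr \<C>. \<sigma> (G\<^sub>a f) = f"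
    using susp_invertible unfolding invertible_endofunctor_def by blast
  show ?thesis
    using that[of "G\<^sub>a c"] endofunctor_hom[OF G(1) assms(1)] G(2,3) assms HomD[OF assms(1)] by simp
qed

lemma susp_faithful:
  assumes "f \<in> Hom \<C> A B" "g \<in> Hom \<C> A B" "\<sigma> f = \<sigma> g"
  shows "f = g"
  using susp_invertible HomD(1)[OF assms(1)] HomD(1)[OF assms(2)] assms(3)
  unfolding invertible_endofunctor_def by metis

lemma susp_zero:
  assumes "A \<in> Ob \<C>" "B \<in> Ob \<C>"
  shows "\<sigma> (zero_arr \<C> A B) = zero_arr \<C> (\<Sigma> A) (\<Sigma> B)"
proof -
  have z: "zero_arr \<C> A B \<in> Hom \<C> A B" using zero_hom assms by blast
  show ?thesis
    using add_eq_self[OF susp_hom[OF z] susp_hom[OF z]] susp_add[OF z z] add_zero[OF z] by simp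
qed

lemma susp_isomorphic_zero: "isomorphic_zero \<C> A \<Longrightarrow> isomorphic_zero \<C> (\<Sigma> A)"
  using susp_ident susp_zero susp_Ob by (metis isomorphic_zero_iff)

section \<open>Exactness of Hom along a distinguished triangle\<close>

lemma dist_hom:
  assumes "(f, g, h) \<in> Dist \<C>"
  shows "f \<in> Hom \<C> (Dom \<C> f) (Dom \<C> g)" "g \<in> Hom \<C> (Dom \<C> g) (Dom \<C> h)"
    "h \<in> Hom \<C> (Dom \<C> h) (\<Sigma> (Dom \<C> f))"
  using dist_triangle[OF assms] unfolding triangle_def Hom_def by auto

lemma dist_rotateI: "(f, g, h) \<in> Dist \<C> \<Longrightarrow> (g, h, \<ominus> \<sigma> f) \<in> Dist \<C>"
  using dist_rotate dist_triangle by blast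

text \<open>The trivial triangle on \<open>A\<close> maps to the given one by the identity and
  \<open>f\<close>; the third component of the filler makes \<open>g \<cdot> f\<close> factor
  through a zero object.\<close>

lemma dist_comp_zero:
  assumes T: "(f, g, h) \<in> Dist \<C>" and f: "f \<in> Hom \<C> A B" and g: "g \<in> Hom \<C> B C"
  shows "g \<cdot> f = zero_arr \<C> A C"
proof -
  obtain Z where Z: "zero_object \<C> Z" using ex_zero_object by blast
  have Ob: "A \<in> Ob \<C>" "B \<in> Ob \<C>" "C \<in> Ob \<C>" "Z \<in> Ob \<C>"
    using HomD[OF f] HomD[OF g] Z unfolding zero_object_def by auto
  have ds: "Dom \<C> f = A" "Cod \<C> f = B" "Dom \<C> g = B" using HomD[OF f] HomD[OF g] by auto
  have C: "Dom \<C> h = C" using dist_hom(2)[OF T] g by (auto simp: Hom_def)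
  have i: "ident \<C> A \<in> Hom \<C> A A" using ident_hom Ob by blast
  have zz: "zero_arr \<C> Z (\<Sigma> A) \<in> Hom \<C> Z (\<Sigma> A)" "zero_arr \<C> A Z \<in> Hom \<C> A Z"
    using zero_hom Ob susp_Ob by auto
  obtain c where "triangle_morphism \<C> (ident \<C> A, zero_arr \<C> A Z, zero_arr \<C> Z (\<Sigma> A)) (f, g, h)
      (ident \<C> A, f, c)"
    using dist_fill[OF dist_ident[OF Ob(1) Z] T, of "ident \<C> A" f] i f ds HomD[OF i] by auto
  then have c: "c \<in> Hom \<C> Z C" and e: "c \<cdot> zero_arr \<C> A Z = g \<cdot> f"
    using HomD(2)[OF zz(1)] C unfolding triangle_morphism_def by auto
  show ?thesis using comp_zero[OF c] Ob e by simp
qed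

text \<open>\<open>dist_fill\<close> produces third components only. Hence the triangle and the
  trivial triangle on \<open>X\<close> are both rotated, so that the wanted lift appears, suspended,
  in third position and can be desuspended.\<close>

lemma dist_exact:
  assumes T: "(f, g, h) \<in> Dist \<C>" and f: "f \<in> Hom \<C> A B" and g: "g \<in> Hom \<C> B C"
    and x: "x \<in> Hom \<C> X B" and zero: "g \<cdot> x = zero_arr \<C> X C"
  obtains y where "y \<in> Hom \<C> X A" "x = f \<cdot> y"
proof -
  obtain Z where Z: "zero_object \<C> Z" using ex_zero_object by blast
  have Ob: "A \<in> Ob \<C>" "B \<in> Ob \<C>" "C \<in> Ob \<C>" "Z \<in> Ob \<C>" "X \<in> Ob \<C>"
    using HomD[OF f] HomD[OF g] HomD[OF x] Z unfolding zero_object_def by auto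
  have i: "ident \<C> X \<in> Hom \<C> X X" using ident_hom Ob by blast
  have zz: "zero_arr \<C> Z (\<Sigma> X) \<in> Hom \<C> Z (\<Sigma> X)" "zero_arr \<C> X Z \<in> Hom \<C> X Z"
    "zero_arr \<C> Z C \<in> Hom \<C> Z C"
    using zero_hom Ob susp_Ob by auto
  have nx: "\<ominus> \<sigma> (ident \<C> X) \<in> Hom \<C> (\<Sigma> X) (\<Sigma> X)" "\<ominus> \<sigma> f \<in> Hom \<C> (\<Sigma> A) (\<Sigma> B)"
    using neg_hom susp_hom i f by auto
  have "zero_arr \<C> Z C \<cdot> zero_arr \<C> X Z = g \<cdot> x" using zero comp_zero[OF zz(3)] Ob by simp
  then obtain c where "triangle_morphism \<C> (zero_arr \<C> X Z, zero_arr \<C> Z (\<Sigma> X), \<ominus> \<sigma> (ident \<C> X))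
      (g, h, \<ominus> \<sigma> f) (x, zero_arr \<C> Z C, c)"
    using dist_fill[OF dist_rotateI[OF dist_ident[OF Ob(5) Z]] dist_rotateI[OF T], of x "zero_arr \<C> Z C"]
      x zz HomD[OF zz(2)] HomD[OF g] by auto
  then have c: "c \<in> Hom \<C> (\<Sigma> X) (\<Sigma> A)" and e: "\<sigma> x \<cdot> \<ominus> \<sigma> (ident \<C> X) = \<ominus> \<sigma> f \<cdot> c"
    using HomD(2)[OF nx(1)] HomD(2)[OF nx(2)] unfolding triangle_morphism_def by auto
  obtain y where y: "y \<in> Hom \<C> X A" "\<sigma> y = c" using susp_full[OF c] Ob by blast
  \<comment> \<open>Each of the two rotated triangles contributes one sign to the last square, and
    the signs cancel.\<close>
  have "\<ominus> \<sigma> x = \<ominus> (\<sigma> f \<cdot> \<sigma> y)"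
    using e comp_neg[OF susp_hom[OF i] susp_hom[OF x]] neg_comp[OF c susp_hom[OF f]]
      susp_ident[OF Ob(5)] comp_ident[OF susp_hom[OF x]] y by simp
  then have "\<sigma> x = \<sigma> f \<cdot> \<sigma> y"
    using neg_inject susp_hom[OF x] comp_hom[OF susp_hom[OF y(1)] susp_hom[OF f]] by blast
  then have "\<sigma> x = \<sigma> (f \<cdot> y)" using endofunctor_comp[OF susp_endofunctor y(1) f] by simp
  then have "x = f \<cdot> y" using susp_faithful[OF x comp_hom[OF y(1) f]] by blast
  with y that show ?thesis by blast
qed

text \<open>Exactness one place further along, by rotating twice: it moves the kernel of composition
  with \<open>f\<close> to arrows into \<open>C\<close>, where a vanishing hypothesis can
  act.\<close>

lemma dist_exact_susp:
  assumes T: "(f, g, h) \<in> Dist \<C>" and f: "f \<in> Hom \<C> A B" and h: "h \<in> Hom \<C> C (\<Sigma> A)"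
    and x: "x \<in> Hom \<C> X A" and zero: "f \<cdot> x = zero_arr \<C> X B"
  obtains y where "y \<in> Hom \<C> (\<Sigma> X) C" "\<sigma> x = h \<cdot> y"
proof -
  have sf: "\<sigma> f \<in> Hom \<C> (\<Sigma> A) (\<Sigma> B)" and sx: "\<sigma> x \<in> Hom \<C> (\<Sigma> X) (\<Sigma> A)"
    using susp_hom f x by auto
  have Ob: "X \<in> Ob \<C>" "B \<in> Ob \<C>" "\<Sigma> X \<in> Ob \<C>" "\<Sigma> B \<in> Ob \<C>"
    using HomD[OF f] HomD[OF x] susp_Ob by auto
  have "\<sigma> f \<cdot> \<sigma> x = zero_arr \<C> (\<Sigma> X) (\<Sigma> B)"
    using endofunctor_comp[OF susp_endofunctor x f] zero susp_zero Ob by simp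
  then have "\<ominus> \<sigma> f \<cdot> \<sigma> x = zero_arr \<C> (\<Sigma> X) (\<Sigma> B)"
    using neg_comp[OF sx sf] neg_zero Ob by simp
  then show ?thesis
    using dist_exact[OF dist_rotateI[OF dist_rotateI[OF T]] h neg_hom(1)[OF sf] sx] that by blast
qed

text \<open>The wanted arrow starts at the third term, so a single filler gives it, once the
  identity of \<open>Y\<close> is placed in second position of a triangle with first term
  zero.\<close>

lemma dist_coexact:
  assumes T: "(f, g, h) \<in> Dist \<C>" and f: "f \<in> Hom \<C> A B" and g: "g \<in> Hom \<C> B C"
    and x: "x \<in> Hom \<C> B Y" and zero: "x \<cdot> f = zero_arr \<C> A Y"
  obtains y where "y \<in> Hom \<C> C Y" "x = y \<cdot> g"
proof -
  obtain Z where "zero_object \<C> Z" using ex_zero_object by blast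
  then have Z: "isomorphic_zero \<C> Z" using zero_object_imp_isomorphic_zero by blast
  have Ob: "A \<in> Ob \<C>" "B \<in> Ob \<C>" "C \<in> Ob \<C>" "Z \<in> Ob \<C>" "Y \<in> Ob \<C>" "\<Sigma> Z \<in> Ob \<C>"
    using HomD[OF f] HomD[OF g] HomD[OF x] Z isomorphic_zero_Ob susp_Ob by auto
  have "zero_object \<C> (\<Sigma> Z)"
    using susp_isomorphic_zero isomorphic_zero_imp_zero_object Z by blast
  \<comment> \<open>Taking \<open>\<Sigma> Z\<close> as the zero object lets this triangle be
    rotated backwards into one that starts at \<open>Z\<close>.\<close>
  then have D: "(ident \<C> Y, zero_arr \<C> Y (\<Sigma> Z), zero_arr \<C> (\<Sigma> Z) (\<Sigma> Y)) \<in> Dist \<C>"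
    using dist_ident Ob by blast
  have i: "ident \<C> Y \<in> Hom \<C> Y Y" using ident_hom Ob by blast
  have zz: "zero_arr \<C> Z Y \<in> Hom \<C> Z Y" "zero_arr \<C> Y (\<Sigma> Z) \<in> Hom \<C> Y (\<Sigma> Z)"
    "zero_arr \<C> A Z \<in> Hom \<C> A Z"
    using zero_hom Ob by auto
  have "triangle \<C> (zero_arr \<C> Z Y, ident \<C> Y, zero_arr \<C> Y (\<Sigma> Z))"
    using HomD[OF zz(1)] HomD[OF zz(2)] HomD[OF i] unfolding triangle_def by auto
  moreover have "\<ominus> \<sigma> (zero_arr \<C> Z Y) = zero_arr \<C> (\<Sigma> Z) (\<Sigma> Y)"
    using susp_zero neg_zero Ob susp_Ob by simp
  ultimately have D': "(zero_arr \<C> Z Y, ident \<C> Y, zero_arr \<C> Y (\<Sigma> Z)) \<in> Dist \<C>"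
    using D dist_rotate by metis
  have "x \<cdot> f = zero_arr \<C> Z Y \<cdot> zero_arr \<C> A Z" using zero comp_zero[OF zz(1)] Ob by simp
  then obtain c where "triangle_morphism \<C> (f, g, h) (zero_arr \<C> Z Y, ident \<C> Y, zero_arr \<C> Y (\<Sigma> Z))
      (zero_arr \<C> A Z, x, c)"
    using dist_fill[OF T D', of "zero_arr \<C> A Z" x] x zz(3) HomD[OF zz(1)] HomD[OF f] by auto
  moreover have "Dom \<C> h = C" using dist_hom(2)[OF T] g by (auto simp: Hom_def)
  ultimately have "c \<in> Hom \<C> C Y" "c \<cdot> g = ident \<C> Y \<cdot> x"
    using HomD(2)[OF zz(2)] unfolding triangle_morphism_def by auto
  with that show ?thesis using ident_comp[OF x] by simp
qed

text \<open>The identity of \<open>B\<close> dies in \<open>C\<close>, hence lifts to a section of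
  \<open>f\<close>. The section is also a left inverse because the kernel of composition with
  \<open>f\<close> on endomorphisms of \<open>A\<close> comes from arrows into the zero object
  \<open>C\<close>.\<close>

lemma dist_cone_zero_Iso:
  assumes T: "(f, g, h) \<in> Dist \<C>" and f: "f \<in> Hom \<C> A B" and g: "g \<in> Hom \<C> B C"
    and zero: "isomorphic_zero \<C> C"
  shows "f \<in> Iso \<C> A B"
proof -
  have Ob: "A \<in> Ob \<C>" "B \<in> Ob \<C>" "C \<in> Ob \<C>" using HomD[OF f] HomD[OF g] by auto
  have i: "ident \<C> B \<in> Hom \<C> B B" "ident \<C> A \<in> Hom \<C> A A" using ident_hom Ob by auto
  have h: "h \<in> Hom \<C> C (\<Sigma> A)" using dist_hom[OF T] f g by (auto simp: Hom_def)
  obtain y where y: "y \<in> Hom \<C> B A" "ident \<C> B = f \<cdot> y"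
    using dist_exact[OF T f g i(1) to_isomorphic_zero[OF zero comp_hom[OF i(1) g]]] .
  have "f \<cdot> (y \<cdot> f) = f \<cdot> ident \<C> A"
    using comp_assoc[OF f y(1) f] y(2) ident_comp[OF f] comp_ident[OF f] by simp
  then have "y \<cdot> f = ident \<C> A"
  proof (rule monicI[OF f comp_hom[OF f y(1)] i(2)])
    fix d assume d: "d \<in> Hom \<C> A A" "f \<cdot> d = zero_arr \<C> A B"
    obtain z where z: "z \<in> Hom \<C> (\<Sigma> A) C" "\<sigma> d = h \<cdot> z" using dist_exact_susp[OF T f h d] .
    have "\<sigma> d = zero_arr \<C> (\<Sigma> A) (\<Sigma> A)"
      using to_isomorphic_zero[OF zero z(1)] z(2) comp_zero[OF h] susp_Ob Ob by simp
    then show "d = zero_arr \<C> A A"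
      using susp_faithful d(1) zero_hom Ob susp_zero by metis
  qed
  then show ?thesis using IsoI[OF f y(1)] y(2) by simp
qed

lemma dist_fibre_zero_Iso:
  assumes T: "(f, g, h) \<in> Dist \<C>" and f: "f \<in> Hom \<C> A B" and g: "g \<in> Hom \<C> B C"
    and zero: "isomorphic_zero \<C> A"
  shows "g \<in> Iso \<C> B C"
proof -
  have "h \<in> Hom \<C> C (\<Sigma> A)" using dist_hom[OF T] f g by (auto simp: Hom_def)
  then show ?thesis
    using dist_cone_zero_Iso[OF dist_rotateI[OF T] g] susp_isomorphic_zero[OF zero] by blast
qed

text \<open>Serves to replace \<open>\<I> \<odot> A\<close> or \<open>A \<odot> \<I>\<close> by
  \<open>A\<close> in the middle of a tensored triangle.\<close>

lemma dist_replace_middle: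
  assumes T: "(f, g, h) \<in> Dist \<C>" and f: "f \<in> Hom \<C> A B" and g: "g \<in> Hom \<C> B C"
    and l: "l \<in> Hom \<C> B B'" and k: "k \<in> Hom \<C> B' B"
    and kl: "k \<cdot> l = ident \<C> B" and lk: "l \<cdot> k = ident \<C> B'"
  shows "(l \<cdot> f, g \<cdot> k, h) \<in> Dist \<C>"
proof (rule dist_iso[OF T])
  have h: "h \<in> Hom \<C> C (\<Sigma> A)" using dist_hom[OF T] f g by (auto simp: Hom_def)
  have lf: "l \<cdot> f \<in> Hom \<C> A B'" and gk: "g \<cdot> k \<in> Hom \<C> B' C" using comp_hom f g l k by auto
  have Ob: "A \<in> Ob \<C>" "C \<in> Ob \<C>" using HomD[OF f] HomD[OF g] by auto
  have iA: "ident \<C> A \<in> Iso \<C> A A" and iC: "ident \<C> C \<in> Iso \<C> C C" and li: "l \<in> Iso \<C> B B'"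
    using ident_Iso Ob IsoI[OF l k kl lk] by auto
  show "triangle \<C> (l \<cdot> f, g \<cdot> k, h)"
    using HomD[OF lf] HomD[OF gk] HomD[OF h] unfolding triangle_def by auto
  have "ident \<C> C \<cdot> g = g \<cdot> k \<cdot> l"
    using comp_assoc[OF l k g] kl comp_ident[OF g] ident_comp[OF g] by simp
  moreover have "\<sigma> (ident \<C> A) \<cdot> h = h \<cdot> ident \<C> C"
    using susp_ident[OF Ob(1)] ident_comp[OF h] comp_ident[OF h] by simp
  ultimately show "triangle_iso \<C> (f, g, h) (l \<cdot> f, g \<cdot> k, h) (ident \<C> A, l, ident \<C> C)"
    using iA iC li comp_ident[OF lf] HomD(2)[OF lf] HomD(2)[OF gk] HomD(2)[OF h] HomD(2)[OF f] HomD(2)[OF g]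
    unfolding triangle_iso_def triangle_morphism_def Iso_def by auto
qed

section \<open>Morphisms of triangles over a common middle object\<close>

lemma triangle_morphism_iff:
  assumes "f \<in> Hom \<C> A B" "g \<in> Hom \<C> B D" "h \<in> Hom \<C> D (\<Sigma> A)"
    and "f' \<in> Hom \<C> A' B'" "g' \<in> Hom \<C> B' D'" "h' \<in> Hom \<C> D' (\<Sigma> A')"
  shows "triangle_morphism \<C> (f, g, h) (f', g', h') (a, b, c) \<longleftrightarrow>
    a \<in> Hom \<C> A A' \<and> b \<in> Hom \<C> B B' \<and> c \<in> Hom \<C> D D' \<and>
    b \<cdot> f = f' \<cdot> a \<and> c \<cdot> g = g' \<cdot> b \<and> \<sigma> a \<cdot> h = h' \<cdot> c"
  using HomD(2)[OF assms(1)] HomD(2)[OF assms(2)] HomD(2)[OF assms(3)]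
    HomD(2)[OF assms(4)] HomD(2)[OF assms(5)] HomD(2)[OF assms(6)]
  unfolding triangle_morphism_def by simp

lemma triangle_morphism_ident:
  assumes f: "f \<in> Hom \<C> A B" and g: "g \<in> Hom \<C> B D" and h: "h \<in> Hom \<C> D (\<Sigma> A)"
  shows "triangle_morphism \<C> (f, g, h) (f, g, h) (ident \<C> A, ident \<C> B, ident \<C> D)"
  using HomD[OF f] HomD[OF g] HomD[OF h] susp_ident
    comp_ident[OF f] comp_ident[OF g] comp_ident[OF h]
    ident_comp[OF f] ident_comp[OF g] ident_comp[OF h]
  by (simp add: triangle_morphism_iff[OF f g h f g h] ident_hom)

lemma triangle_morphism_comp:
  assumes f: "f \<in> Hom \<C> A B" and g: "g \<in> Hom \<C> B D" and h: "h \<in> Hom \<C> D (\<Sigma> A)"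
    and f': "f' \<in> Hom \<C> A' B'" and g': "g' \<in> Hom \<C> B' D'" and h': "h' \<in> Hom \<C> D' (\<Sigma> A')"
    and f'': "f'' \<in> Hom \<C> A'' B''" and g'': "g'' \<in> Hom \<C> B'' D''" and h'': "h'' \<in> Hom \<C> D'' (\<Sigma> A'')"
    and 1: "triangle_morphism \<C> (f, g, h) (f', g', h') (a, b, c)"
    and 2: "triangle_morphism \<C> (f', g', h') (f'', g'', h'') (a', b', c')"
  shows "triangle_morphism \<C> (f, g, h) (f'', g'', h'') (a' \<cdot> a, b' \<cdot> b, c' \<cdot> c)"
proof -
  have a: "a \<in> Hom \<C> A A'" and b: "b \<in> Hom \<C> B B'" and c: "c \<in> Hom \<C> D D'"
    and e: "b \<cdot> f = f' \<cdot> a" "c \<cdot> g = g' \<cdot> b" "\<sigma> a \<cdot> h = h' \<cdot> c"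
    using 1 unfolding triangle_morphism_iff[OF f g h f' g' h'] by auto
  have a': "a' \<in> Hom \<C> A' A''" and b': "b' \<in> Hom \<C> B' B''" and c': "c' \<in> Hom \<C> D' D''"
    and e': "b' \<cdot> f' = f'' \<cdot> a'" "c' \<cdot> g' = g'' \<cdot> b'" "\<sigma> a' \<cdot> h' = h'' \<cdot> c'"
    using 2 unfolding triangle_morphism_iff[OF f' g' h' f'' g'' h''] by auto
  have "b' \<cdot> b \<cdot> f = f'' \<cdot> (a' \<cdot> a)"
    using comp_assoc[OF f b b'] comp_assoc[OF a f' b'] comp_assoc[OF a a' f''] e e' by simp
  moreover have "c' \<cdot> c \<cdot> g = g'' \<cdot> (b' \<cdot> b)"
    using comp_assoc[OF g c c'] comp_assoc[OF b g' c'] comp_assoc[OF b b' g''] e e' by simp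
  moreover have "\<sigma> (a' \<cdot> a) \<cdot> h = h'' \<cdot> (c' \<cdot> c)"
    using endofunctor_comp[OF susp_endofunctor a a'] comp_assoc[OF h susp_hom[OF a] susp_hom[OF a']]
      comp_assoc[OF c h' susp_hom[OF a']] comp_assoc[OF c c' h''] e e' by simp
  ultimately show ?thesis
    unfolding triangle_morphism_iff[OF f g h f'' g'' h'']
    using comp_hom[OF a a'] comp_hom[OF b b'] comp_hom[OF c c'] by blast
qed

text \<open>The composite of \<open>f\<close> with \<open>g'\<close> lies in the vanishing Hom
  group, so \<open>f\<close> lifts through \<open>f'\<close>; the filler does the rest.\<close>

lemma dist_comparison_ex:
  assumes T: "(f, g, h) \<in> Dist \<C>" "f \<in> Hom \<C> A B" "g \<in> Hom \<C> B D"
    and T': "(f', g', h') \<in> Dist \<C>" "f' \<in> Hom \<C> A' B" "g' \<in> Hom \<C> B D'"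
    and zero: "\<And>x. x \<in> Hom \<C> A D' \<Longrightarrow> x = zero_arr \<C> A D'"
  obtains a c where "triangle_morphism \<C> (f, g, h) (f', g', h') (a, ident \<C> B, c)"
proof -
  obtain a where a: "a \<in> Hom \<C> A A'" "f = f' \<cdot> a"
    using dist_exact[OF T' T(2) zero[OF comp_hom[OF T(2) T'(3)]]] .
  have "ident \<C> B \<cdot> f = f' \<cdot> a" using ident_comp T(2) a(2) by metis
  then show ?thesis
    using dist_fill[OF T(1) T'(1), of a "ident \<C> B"] that a(1)
      HomD[OF T(2)] HomD[OF T'(2)] ident_hom by auto
qed

text \<open>A single vanishing controls both components: a difference of first components, once
  suspended, factors as \<open>h'\<close> after an arrow from \<open>\<Sigma> A\<close> to
  \<open>D'\<close>, and a difference of third components as such an arrow after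
  \<open>h\<close>.\<close>

lemma dist_comparison_unique:
  assumes T: "(f, g, h) \<in> Dist \<C>" "f \<in> Hom \<C> A B" "g \<in> Hom \<C> B D" "h \<in> Hom \<C> D (\<Sigma> A)"
    and T': "(f', g', h') \<in> Dist \<C>" "f' \<in> Hom \<C> A' B'" "g' \<in> Hom \<C> B' D'" "h' \<in> Hom \<C> D' (\<Sigma> A')"
    and zero: "\<And>x. x \<in> Hom \<C> (\<Sigma> A) D' \<Longrightarrow> x = zero_arr \<C> (\<Sigma> A) D'"
    and 1: "triangle_morphism \<C> (f, g, h) (f', g', h') (a, b, c)"
    and 2: "triangle_morphism \<C> (f, g, h) (f', g', h') (a', b, c')"
  shows "a = a'" "c = c'"
proof -
  note iff = triangle_morphism_iff[OF T(2-4) T'(2-4)]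
  have a: "a \<in> Hom \<C> A A'" "a' \<in> Hom \<C> A A'" and c: "c \<in> Hom \<C> D D'" "c' \<in> Hom \<C> D D'"
    and e: "f' \<cdot> a = f' \<cdot> a'" "c \<cdot> g = c' \<cdot> g"
    using 1 2 unfolding iff by auto
  have Ob: "A \<in> Ob \<C>" "A' \<in> Ob \<C>" "D \<in> Ob \<C>" "D' \<in> Ob \<C>" "\<Sigma> A \<in> Ob \<C>" "\<Sigma> A' \<in> Ob \<C>"
    using HomD[OF a(1)] HomD[OF c(1)] susp_Ob by auto
  show "a = a'"
  proof (rule monicI[OF T'(2) a e(1)])
    fix d assume d: "d \<in> Hom \<C> A A'" "f' \<cdot> d = zero_arr \<C> A B'"
    obtain y where y: "y \<in> Hom \<C> (\<Sigma> A) D'" "\<sigma> d = h' \<cdot> y"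
      using dist_exact_susp[OF T'(1,2,4) d] .
    have "\<sigma> d = zero_arr \<C> (\<Sigma> A) (\<Sigma> A')"
      using zero[OF y(1)] y(2) comp_zero[OF T'(4)] Ob by simp
    then show "d = zero_arr \<C> A A'" using susp_faithful d(1) zero_hom Ob susp_zero by metis
  qed
  show "c = c'"
  proof (rule epicI[OF T(3) c e(2)])
    fix d assume d: "d \<in> Hom \<C> D D'" "d \<cdot> g = zero_arr \<C> B D'"
    obtain y where y: "y \<in> Hom \<C> (\<Sigma> A) D'" "d = y \<cdot> h"
      using dist_coexact[OF dist_rotateI[OF T(1)] T(3,4) d] .
    then show "d = zero_arr \<C> D D'" using zero[OF y(1)] zero_comp[OF T(4)] Ob by simp
  qed
qed

text \<open>The hypothesis includes arrows from \<open>A\<close> and \<open>\<Sigma> A\<close> to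
  \<open>D\<close> within the same triangle, and likewise for the primed one, because the composites
  of the two comparisons are recognised as identities by uniqueness of endomorphisms.\<close>

lemma dist_comparison_iso:
  assumes T: "(f, g, h) \<in> Dist \<C>" "f \<in> Hom \<C> A B" "g \<in> Hom \<C> B D" "h \<in> Hom \<C> D (\<Sigma> A)"
    and T': "(f', g', h') \<in> Dist \<C>" "f' \<in> Hom \<C> A' B" "g' \<in> Hom \<C> B D'" "h' \<in> Hom \<C> D' (\<Sigma> A')"
    and zero: "\<And>X Y x. \<lbrakk>X \<in> {A, \<Sigma> A, A', \<Sigma> A'}; Y \<in> {D, D'}; x \<in> Hom \<C> X Y\<rbrakk> \<Longrightarrow> x = zero_arr \<C> X Y"
  shows "\<exists>!(a, c). triangle_iso \<C> (f, g, h) (f', g', h') (a, ident \<C> B, c)"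
proof -
  have B: "B \<in> Ob \<C>" using HomD[OF T(2)] by blast
  have iB: "ident \<C> B \<in> Hom \<C> B B" using ident_hom B .
  have z: "x = zero_arr \<C> A D'" if "x \<in> Hom \<C> A D'" for x using zero that by blast
  have z': "x = zero_arr \<C> A' D" if "x \<in> Hom \<C> A' D" for x using zero that by blast
  have sz: "x = zero_arr \<C> (\<Sigma> A) Y" if "x \<in> Hom \<C> (\<Sigma> A) Y" "Y \<in> {D, D'}" for x Y
    using zero that by blast
  have sz': "x = zero_arr \<C> (\<Sigma> A') Y" if "x \<in> Hom \<C> (\<Sigma> A') Y" "Y \<in> {D, D'}" for x Y
    using zero that by blast
  obtain a c where 1: "triangle_morphism \<C> (f, g, h) (f', g', h') (a, ident \<C> B, c)"
    using dist_comparison_ex[OF T(1-3) T'(1-3) z] by metis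
  obtain a' c' where 2: "triangle_morphism \<C> (f', g', h') (f, g, h) (a', ident \<C> B, c')"
    using dist_comparison_ex[OF T'(1-3) T(1-3) z'] by metis
  have "triangle_morphism \<C> (f, g, h) (f, g, h) (a' \<cdot> a, ident \<C> B, c' \<cdot> c)"
    using triangle_morphism_comp[OF T(2-4) T'(2-4) T(2-4) 1 2] comp_ident[OF iB] by simp
  from dist_comparison_unique[OF T T sz this triangle_morphism_ident[OF T(2-4)]]
  have inv: "a' \<cdot> a = ident \<C> A" "c' \<cdot> c = ident \<C> D" by simp_all
  have "triangle_morphism \<C> (f', g', h') (f', g', h') (a \<cdot> a', ident \<C> B, c \<cdot> c')"
    using triangle_morphism_comp[OF T'(2-4) T(2-4) T'(2-4) 2 1] comp_ident[OF iB] by simp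
  from dist_comparison_unique[OF T' T' sz' this triangle_morphism_ident[OF T'(2-4)]]
  have inv': "a \<cdot> a' = ident \<C> A'" "c \<cdot> c' = ident \<C> D'" by simp_all
  have "a \<in> Hom \<C> A A'" "a' \<in> Hom \<C> A' A" "c \<in> Hom \<C> D D'" "c' \<in> Hom \<C> D' D"
    using 1 2
    unfolding triangle_morphism_iff[OF T(2-4) T'(2-4)] triangle_morphism_iff[OF T'(2-4) T(2-4)]
    by auto
  then have "a \<in> Iso \<C> A A'" "c \<in> Iso \<C> D D'" "ident \<C> B \<in> Iso \<C> B B"
    using inv inv' ident_Iso[OF B] IsoI by auto
  then have "triangle_iso \<C> (f, g, h) (f', g', h') (a, ident \<C> B, c)"
    using 1 unfolding triangle_iso_def Iso_def by simp
  moreover have "x = a" "y = c" if "triangle_iso \<C> (f, g, h) (f', g', h') (x, ident \<C> B, y)" for x y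
  proof -
    have "triangle_morphism \<C> (f, g, h) (f', g', h') (x, ident \<C> B, y)"
      using that unfolding triangle_iso_def by simp
    from dist_comparison_unique[OF T T' sz this 1] show "x = a" "y = c" by simp_all
  qed
  ultimately show ?thesis by (intro ex1I[of _ "(a, c)"]) blast+
qed

end

section \<open>Complementary idempotent endofunctors\<close>

text \<open>An abstraction of the two situations \<open>(P, Q) = (C \<odot> -, U \<odot> -)\<close> and
  \<open>(P, Q) = (- \<odot> C, - \<odot> U)\<close>, so that left and right are treated at once.\<close>

locale idempotent_pair = triangulated_category \<C>
  for \<C> :: "('o, 'a, 'x) triangulated_category_scheme" (structure) +
  fixes P\<^sub>o :: "'o \<Rightarrow> 'o" and P\<^sub>a :: "'a \<Rightarrow> 'a" and Q\<^sub>o :: "'o \<Rightarrow> 'o" and Q\<^sub>a :: "'a \<Rightarrow> 'a"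
    and e :: "'o \<Rightarrow> 'a" and n :: "'o \<Rightarrow> 'a"
  assumes P_functor: "endofunctor \<C> P\<^sub>o P\<^sub>a"
    and Q_functor: "endofunctor \<C> Q\<^sub>o Q\<^sub>a"
    and e_hom: "A \<in> Ob \<C> \<Longrightarrow> e A \<in> Hom \<C> (P\<^sub>o A) A"
    and n_hom: "A \<in> Ob \<C> \<Longrightarrow> n A \<in> Hom \<C> A (Q\<^sub>o A)"
    and e_natural: "f \<in> Hom \<C> A B \<Longrightarrow> e B \<cdot> P\<^sub>a f = f \<cdot> e A"
    and e_n_dist: "A \<in> Ob \<C> \<Longrightarrow> \<exists>h. (e A, n A, h) \<in> Dist \<C>"
    and PQ_zero: "A \<in> Ob \<C> \<Longrightarrow> isomorphic_zero \<C> (P\<^sub>o (Q\<^sub>o A))"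
    and QP_zero: "A \<in> Ob \<C> \<Longrightarrow> isomorphic_zero \<C> (Q\<^sub>o (P\<^sub>o A))"
    and Q_susp: "\<lbrakk>A \<in> Ob \<C>; isomorphic_zero \<C> (Q\<^sub>o A)\<rbrakk> \<Longrightarrow> isomorphic_zero \<C> (Q\<^sub>o (\<Sigma> A))"
begin

lemma e_Iso:
  assumes "A \<in> Ob \<C>" "isomorphic_zero \<C> (Q\<^sub>o A)"
  shows "e A \<in> Iso \<C> (P\<^sub>o A) A"
  using e_n_dist[OF assms(1)] dist_cone_zero_Iso[OF _ e_hom n_hom] assms by blast

lemma n_Iso:
  assumes "A \<in> Ob \<C>" "isomorphic_zero \<C> (P\<^sub>o A)"
  shows "n A \<in> Iso \<C> A (Q\<^sub>o A)"
  using e_n_dist[OF assms(1)] dist_fibre_zero_Iso[OF _ e_hom n_hom] assms by blast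

text \<open>For the forward direction any isomorphism will do: applying \<open>Q\<close> to it
  identifies the image of \<open>A\<close> with that of \<open>P\<^sub>o A\<close>, which is zero.
  The converse takes the canonical arrow \<open>e A\<close>.\<close>

lemma P_fixed_iff:
  assumes A: "A \<in> Ob \<C>"
  shows "isomorphic \<C> (P\<^sub>o A) A \<longleftrightarrow> isomorphic_zero \<C> (Q\<^sub>o A)"
proof
  assume "isomorphic \<C> (P\<^sub>o A) A"
  then have "isomorphic \<C> (Q\<^sub>o A) (Q\<^sub>o (P\<^sub>o A))"
    using endofunctor_isomorphic[OF Q_functor] isomorphic_sym by blast
  then show "isomorphic_zero \<C> (Q\<^sub>o A)" using isomorphic_zero_cong QP_zero[OF A] by blast
qed (rule isomorphicI[OF e_Iso[OF A]])

lemma Q_fixed_iff: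
  assumes A: "A \<in> Ob \<C>"
  shows "isomorphic \<C> (Q\<^sub>o A) A \<longleftrightarrow> isomorphic_zero \<C> (P\<^sub>o A)"
proof
  assume "isomorphic \<C> (Q\<^sub>o A) A"
  then have "isomorphic \<C> (P\<^sub>o A) (P\<^sub>o (Q\<^sub>o A))"
    using endofunctor_isomorphic[OF P_functor] isomorphic_sym by blast
  then show "isomorphic_zero \<C> (P\<^sub>o A)" using isomorphic_zero_cong PQ_zero[OF A] by blast
qed (rule isomorphic_sym[OF isomorphicI[OF n_Iso[OF A]]])

lemma hom_zero:
  assumes X: "isomorphic_zero \<C> (Q\<^sub>o X)" and Y: "isomorphic_zero \<C> (P\<^sub>o Y)" and f: "f \<in> Hom \<C> X Y"
  shows "f = zero_arr \<C> X Y"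
proof -
  have Ob: "X \<in> Ob \<C>" "Y \<in> Ob \<C>" "P\<^sub>o X \<in> Ob \<C>"
    using HomD[OF f] P_functor unfolding endofunctor_def by auto
  obtain k where k: "k \<in> Hom \<C> X (P\<^sub>o X)" "e X \<cdot> k = ident \<C> X"
    using e_Iso[OF Ob(1) X] by (rule IsoE)
  have "P\<^sub>a f = zero_arr \<C> (P\<^sub>o X) (P\<^sub>o Y)"
    using to_isomorphic_zero[OF Y endofunctor_hom[OF P_functor f]] .
  then have "f \<cdot> e X = zero_arr \<C> (P\<^sub>o X) Y" using e_natural[OF f] comp_zero[OF e_hom] Ob by simp
  then have "f \<cdot> e X \<cdot> k = zero_arr \<C> X Y" using zero_comp[OF k(1)] Ob by simp
  then show ?thesis using comp_assoc[OF k(1) e_hom[OF Ob(1)] f] k(2) comp_ident[OF f] by simp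
qed

text \<open>The shifted source is what uniqueness of comparisons requires; \<open>Q_susp\<close>
  reduces it to the unshifted case.\<close>

lemma hom_zero_susp:
  assumes "isomorphic_zero \<C> (Q\<^sub>o X)" "X \<in> Ob \<C>" "isomorphic_zero \<C> (P\<^sub>o Y)"
    and "X' \<in> {X, \<Sigma> X}" "f \<in> Hom \<C> X' Y"
  shows "f = zero_arr \<C> X' Y"
  using hom_zero Q_susp assms by blast

end

text \<open>Vanishing needs one pair that governs both objects. If the objects killed by
  \<open>P\<close> and \<open>P'\<close> agree, \<open>Y\<close> passes to the first pair; if those
  killed by \<open>Q\<close> and \<open>Q'\<close> agree, \<open>X\<close> passes to the
  second.\<close>

lemma hom_zero_of_coincidence:
  fixes \<C> (structure)
  assumes 1: "idempotent_pair \<C> P P\<^sub>a Q Q\<^sub>a e n" and 2: "idempotent_pair \<C> P' P\<^sub>a' Q' Q\<^sub>a' e' n'"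
    and X: "isomorphic_zero \<C> (Q X)" "X \<in> Ob \<C>" and Y: "isomorphic_zero \<C> (P' Y)" "Y \<in> Ob \<C>"
    and coincide: "(\<forall>A\<in>Ob \<C>. isomorphic_zero \<C> (P A) \<longleftrightarrow> isomorphic_zero \<C> (P' A)) \<or>
      (\<forall>A\<in>Ob \<C>. isomorphic_zero \<C> (Q A) \<longleftrightarrow> isomorphic_zero \<C> (Q' A))"
    and "X' \<in> {X, \<Sigma> X}" "f \<in> Hom \<C> X' Y"
  shows "f = zero_arr \<C> X' Y"
  using coincide
proof
  assume "\<forall>A\<in>Ob \<C>. isomorphic_zero \<C> (P A) \<longleftrightarrow> isomorphic_zero \<C> (P' A)"
  then have "isomorphic_zero \<C> (P Y)" using Y by blast
  then show ?thesis using idempotent_pair.hom_zero_susp[OF 1 X] assms(8,9) by blast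
next
  assume "\<forall>A\<in>Ob \<C>. isomorphic_zero \<C> (Q A) \<longleftrightarrow> isomorphic_zero \<C> (Q' A)"
  then have "isomorphic_zero \<C> (Q' X)" using X by blast
  then show ?thesis using idempotent_pair.hom_zero_susp[OF 2 _ X(2) Y(1)] assms(8,9) by blast
qed

section \<open>Complementary idempotents\<close>

lemma full_subcategory_eq_iff: "full_subcategory \<C> S = full_subcategory \<C> T \<longleftrightarrow> S = T"
  unfolding full_subcategory_def by auto

lemma left_fixed_eq_iff: "left_fixed \<C> E = left_fixed \<C> E' \<longleftrightarrow>
    (\<forall>A\<in>Ob \<C>. isomorphic \<C> (E \<odot>\<^bsub>\<C>\<^esub> A) A \<longleftrightarrow> isomorphic \<C> (E' \<odot>\<^bsub>\<C>\<^esub> A) A)"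
  unfolding left_fixed_def full_subcategory_eq_iff by blast

lemma left_killed_eq_iff: "left_killed \<C> E = left_killed \<C> E' \<longleftrightarrow>
    (\<forall>A\<in>Ob \<C>. isomorphic_zero \<C> (E \<odot>\<^bsub>\<C>\<^esub> A) \<longleftrightarrow> isomorphic_zero \<C> (E' \<odot>\<^bsub>\<C>\<^esub> A))"
  unfolding left_killed_def full_subcategory_eq_iff by blast

lemma right_fixed_eq_iff: "right_fixed \<C> E = right_fixed \<C> E' \<longleftrightarrow>
    (\<forall>A\<in>Ob \<C>. isomorphic \<C> (A \<odot>\<^bsub>\<C>\<^esub> E) A \<longleftrightarrow> isomorphic \<C> (A \<odot>\<^bsub>\<C>\<^esub> E') A)"
  unfolding right_fixed_def full_subcategory_eq_iff by blast

lemma right_killed_eq_iff: "right_killed \<C> E = right_killed \<C> E' \<longleftrightarrow>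
    (\<forall>A\<in>Ob \<C>. isomorphic_zero \<C> (A \<odot>\<^bsub>\<C>\<^esub> E) \<longleftrightarrow> isomorphic_zero \<C> (A \<odot>\<^bsub>\<C>\<^esub> E'))"
  unfolding right_killed_def full_subcategory_eq_iff by blast

context triangulated_monoidal_category
begin

section \<open>Zero objects and suspensions under the tensor product\<close>

lemma tensor_isomorphic:
  assumes "isomorphic \<C> A A'" "isomorphic \<C> B B'"
  shows "isomorphic \<C> (A \<odot> B) (A' \<odot> B')"
proof -
  obtain f g where f: "f \<in> Hom \<C> A A'" and g: "g \<in> Hom \<C> A' A"
    and fg: "g \<cdot> f = ident \<C> A" "f \<cdot> g = ident \<C> A'" using assms(1) by (rule isomorphicE)
  obtain h k where h: "h \<in> Hom \<C> B B'" and k: "k \<in> Hom \<C> B' B"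
    and hk: "k \<cdot> h = ident \<C> B" "h \<cdot> k = ident \<C> B'" using assms(2) by (rule isomorphicE)
  have "(g \<boxtimes> k) \<cdot> (f \<boxtimes> h) = ident \<C> (A \<odot> B)" "(f \<boxtimes> h) \<cdot> (g \<boxtimes> k) = ident \<C> (A' \<odot> B')"
    using tensor_comp[OF f g h k] tensor_comp[OF g f k h] fg hk tensor_ident HomD[OF f] HomD[OF h]
    by auto
  then show ?thesis using IsoI tensor_hom[OF f h] tensor_hom[OF g k] isomorphicI by blast
qed

lemma assoc_isomorphic:
  "\<lbrakk>A \<in> Ob \<C>; B \<in> Ob \<C>; D \<in> Ob \<C>\<rbrakk> \<Longrightarrow> isomorphic \<C> (A \<odot> B \<odot> D) (A \<odot> (B \<odot> D))"
  using assoc_iso isomorphicI by blast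

text \<open>Exactness replaces additivity of \<open>\<boxtimes>\<close>: tensoring a triangle whose
  first two arrows are identities of \<open>Z\<close> again gives identities, and consecutive arrows
  of a distinguished triangle compose to zero.\<close>

lemma tensor_zero:
  assumes Z: "isomorphic_zero \<C> Z" and D: "D \<in> Ob \<C>"
  shows "isomorphic_zero \<C> (Z \<odot> D)" "isomorphic_zero \<C> (D \<odot> Z)"
proof -
  have ZOb: "Z \<in> Ob \<C>" and id0: "zero_arr \<C> Z Z = ident \<C> Z"
    using Z by (auto simp: isomorphic_zero_iff)
  have i: "ident \<C> (Z \<odot> D) \<in> Hom \<C> (Z \<odot> D) (Z \<odot> D)" "ident \<C> (D \<odot> Z) \<in> Hom \<C> (D \<odot> Z) (D \<odot> Z)"
    using ident_hom tensor_ob ZOb D by auto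
  \<comment> \<open>This is the trivial triangle on \<open>Z\<close> with \<open>Z\<close> itself as
    the zero object, where the zero endomorphism is the identity.\<close>
  have T: "(ident \<C> Z, ident \<C> Z, zero_arr \<C> Z (\<Sigma> Z)) \<in> Dist \<C>"
    using dist_ident[OF ZOb isomorphic_zero_imp_zero_object[OF Z]] id0 by simp
  have "ident \<C> (Z \<odot> D) = zero_arr \<C> (Z \<odot> D) (Z \<odot> D)"
    using dist_comp_zero[OF tensor_dist_right[OF T D, unfolded tensor_ident[OF ZOb D]] i(1) i(1)]
      comp_ident[OF i(1)] by simp
  moreover have "ident \<C> (D \<odot> Z) = zero_arr \<C> (D \<odot> Z) (D \<odot> Z)"
    using dist_comp_zero[OF tensor_dist_left[OF T D, unfolded tensor_ident[OF D ZOb]] i(2) i(2)]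
      comp_ident[OF i(2)] by simp
  ultimately show "isomorphic_zero \<C> (Z \<odot> D)" "isomorphic_zero \<C> (D \<odot> Z)"
    using tensor_ob ZOb D by (auto simp: isomorphic_zero_iff)
qed

lemma tensor_zero_assoc:
  assumes "A \<in> Ob \<C>" "B \<in> Ob \<C>" "D \<in> Ob \<C>"
  shows "isomorphic_zero \<C> (A \<odot> B) \<Longrightarrow> isomorphic_zero \<C> (A \<odot> (B \<odot> D))"
    and "isomorphic_zero \<C> (B \<odot> D) \<Longrightarrow> isomorphic_zero \<C> (A \<odot> B \<odot> D)"
  using isomorphic_zero_cong[OF isomorphic_sym[OF assoc_isomorphic[OF assms]] tensor_zero(1)]
    isomorphic_zero_cong[OF assoc_isomorphic[OF assms] tensor_zero(2)] assms by auto

lemma susp_isomorphic_tensor: "A \<in> Ob \<C> \<Longrightarrow> isomorphic \<C> (\<Sigma> A) (A \<odot> \<Sigma> \<I>)"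
  using alpha_iso isomorphicI isomorphic_sym by blast

text \<open>By \<open>\<alpha>\<close> a suspension is a tensor factor \<open>\<Sigma> \<I>\<close>
  on the right. On the second factor it is split off by associativity; on the first it sits between
  \<open>A\<close> and \<open>B\<close>, and \<open>\<beta>\<close> carries it past
  \<open>B\<close>.\<close>

lemma tensor_zero_susp:
  assumes Ob: "A \<in> Ob \<C>" "B \<in> Ob \<C>" and zero: "isomorphic_zero \<C> (A \<odot> B)"
  shows "isomorphic_zero \<C> (A \<odot> \<Sigma> B)" "isomorphic_zero \<C> (\<Sigma> A \<odot> B)"
proof -
  have S: "\<Sigma> \<I> \<in> Ob \<C>" using susp_Ob unit_ob .
  have z: "isomorphic_zero \<C> (A \<odot> (B \<odot> \<Sigma> \<I>))" using tensor_zero_assoc Ob S zero by blast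
  show "isomorphic_zero \<C> (A \<odot> \<Sigma> B)"
    using isomorphic_zero_cong[OF tensor_isomorphic[OF isomorphic_refl susp_isomorphic_tensor] z] Ob .
  have "isomorphic_zero \<C> (A \<odot> (\<Sigma> \<I> \<odot> B))"
    using isomorphic_zero_cong[OF tensor_isomorphic[OF isomorphic_refl isomorphicI[OF beta_iso]] z] Ob .
  then have "isomorphic_zero \<C> (A \<odot> \<Sigma> \<I> \<odot> B)"
    using isomorphic_zero_cong assoc_isomorphic Ob S by blast
  then show "isomorphic_zero \<C> (\<Sigma> A \<odot> B)"
    using isomorphic_zero_cong tensor_isomorphic[OF susp_isomorphic_tensor isomorphic_refl] Ob by blast
qed

section \<open>Tensoring with complementary idempotents on either side\<close>

lemma tensor_functor_left: "D \<in> Ob \<C> \<Longrightarrow> endofunctor \<C> ((\<odot>) D) ((\<boxtimes>) (ident \<C> D))"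
  using tensor_comp[OF ident_hom ident_hom, of D] comp_ident[OF ident_hom, of D]
  by (intro endofunctorI) (auto intro: tensor_ob tensor_ident tensor_hom ident_hom)

lemma tensor_functor_right: "D \<in> Ob \<C> \<Longrightarrow> endofunctor \<C> (\<lambda>A. A \<odot> D) (\<lambda>f. f \<boxtimes> ident \<C> D)"
  using tensor_comp[OF _ _ ident_hom ident_hom, of _ _ _ _ _ D] comp_ident[OF ident_hom, of D]
  by (intro endofunctorI) (auto intro: tensor_ob tensor_ident tensor_hom ident_hom)

text \<open>The triangle at \<open>A\<close> is the idempotent triangle tensored with
  \<open>A\<close> on the right, with \<open>\<I> \<odot> A\<close> contracted by the left
  unitor.\<close>

lemma idempotent_pair_left:
  assumes "complementary_idempotents \<C> C U \<epsilon> \<eta> \<delta>"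
  obtains e n where
    "idempotent_pair \<C> ((\<odot>) C) ((\<boxtimes>) (ident \<C> C)) ((\<odot>) U) ((\<boxtimes>) (ident \<C> U)) e n"
proof -
  have Ob: "C \<in> Ob \<C>" "U \<in> Ob \<C>" and zero: "isomorphic_zero \<C> (C \<odot> U)" "isomorphic_zero \<C> (U \<odot> C)"
    and \<epsilon>: "\<epsilon> \<in> Hom \<C> C \<I>" and \<eta>: "\<eta> \<in> Hom \<C> \<I> U" and T: "(\<epsilon>, \<eta>, \<delta>) \<in> Dist \<C>"
    using assms unfolding complementary_idempotents_def by auto
  have "\<exists>k. k \<in> Hom \<C> A (\<I> \<odot> A) \<and> k \<cdot> lunit \<C> A = ident \<C> (\<I> \<odot> A) \<and> lunit \<C> A \<cdot> k = ident \<C> A"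
    if "A \<in> Ob \<C>" for A
    using lunit_iso[OF that] by (elim IsoE) blast
  then obtain k where k: "k A \<in> Hom \<C> A (\<I> \<odot> A)" "k A \<cdot> lunit \<C> A = ident \<C> (\<I> \<odot> A)"
    "lunit \<C> A \<cdot> k A = ident \<C> A" if "A \<in> Ob \<C>" for A by metis
  have l: "lunit \<C> A \<in> Hom \<C> (\<I> \<odot> A) A" if "A \<in> Ob \<C>" for A
    using lunit_iso[OF that] by (rule IsoE)
  have \<epsilon>A: "\<epsilon> \<boxtimes> ident \<C> A \<in> Hom \<C> (C \<odot> A) (\<I> \<odot> A)" and \<eta>A: "\<eta> \<boxtimes> ident \<C> A \<in> Hom \<C> (\<I> \<odot> A) (U \<odot> A)"
    if "A \<in> Ob \<C>" for A using tensor_hom \<epsilon> \<eta> ident_hom that by auto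
  let ?e = "\<lambda>A. lunit \<C> A \<cdot> (\<epsilon> \<boxtimes> ident \<C> A)" and ?n = "\<lambda>A. (\<eta> \<boxtimes> ident \<C> A) \<cdot> k A"
  have nat: "?e B \<cdot> (ident \<C> C \<boxtimes> f) = f \<cdot> ?e A" if f: "f \<in> Hom \<C> A B" for f A B
  proof -
    have AB: "A \<in> Ob \<C>" "B \<in> Ob \<C>" using HomD[OF f] by auto
    have iA: "ident \<C> A \<in> Hom \<C> A A" and iB: "ident \<C> B \<in> Hom \<C> B B"
      and iI: "ident \<C> \<I> \<in> Hom \<C> \<I> \<I>" and iC: "ident \<C> C \<in> Hom \<C> C C"
      using ident_hom AB unit_ob Ob by auto
    have If: "ident \<C> \<I> \<boxtimes> f \<in> Hom \<C> (\<I> \<odot> A) (\<I> \<odot> B)" and Cf: "ident \<C> C \<boxtimes> f \<in> Hom \<C> (C \<odot> A) (C \<odot> B)"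
      using tensor_hom f iI iC by auto
    have "?e B \<cdot> (ident \<C> C \<boxtimes> f) = lunit \<C> B \<cdot> ((\<epsilon> \<boxtimes> ident \<C> B) \<cdot> (ident \<C> C \<boxtimes> f))"
      using comp_assoc[OF Cf \<epsilon>A[OF AB(2)] l[OF AB(2)]] by simp
    \<comment> \<open>By the interchange law both sides are
      \<open>\<epsilon> \<boxtimes> f\<close>.\<close>
    also have "(\<epsilon> \<boxtimes> ident \<C> B) \<cdot> (ident \<C> C \<boxtimes> f) = (ident \<C> \<I> \<boxtimes> f) \<cdot> (\<epsilon> \<boxtimes> ident \<C> A)"
      using tensor_comp[OF iC \<epsilon> f iB] tensor_comp[OF \<epsilon> iI iA f] comp_ident[OF \<epsilon>] ident_comp[OF \<epsilon>]
        comp_ident[OF f] ident_comp[OF f] by simp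
    also have "lunit \<C> B \<cdot> \<dots> = f \<cdot> ?e A"
      using comp_assoc[OF \<epsilon>A[OF AB(1)] If l[OF AB(2)]] comp_assoc[OF \<epsilon>A[OF AB(1)] l[OF AB(1)] f]
        lunit_natural[OF f] by simp
    finally show ?thesis .
  qed
  show ?thesis
  proof (rule that[of ?e ?n], unfold_locales)
    show "\<exists>h. (?e A, ?n A, h) \<in> Dist \<C>" if A: "A \<in> Ob \<C>" for A
      using dist_replace_middle[OF tensor_dist_right[OF T A] \<epsilon>A[OF A] \<eta>A[OF A] l[OF A] k[OF A]] by blast
  qed (use Ob zero nat tensor_functor_left tensor_zero_assoc(1) tensor_zero_susp(1)
      comp_hom[OF \<epsilon>A l] comp_hom[OF k(1) \<eta>A] in auto)
qed

text \<open>The mirror image, with one twist: composing the functors reverses the order of the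
  factors, so \<open>PQ_zero\<close> now comes from \<open>U \<odot> C\<close> and
  \<open>QP_zero\<close> from \<open>C \<odot> U\<close>.\<close>

lemma idempotent_pair_right:
  assumes "complementary_idempotents \<C> C U \<epsilon> \<eta> \<delta>"
  obtains e n where
    "idempotent_pair \<C> (\<lambda>A. A \<odot> C) (\<lambda>f. f \<boxtimes> ident \<C> C) (\<lambda>A. A \<odot> U) (\<lambda>f. f \<boxtimes> ident \<C> U) e n"
proof -
  have Ob: "C \<in> Ob \<C>" "U \<in> Ob \<C>" and zero: "isomorphic_zero \<C> (C \<odot> U)" "isomorphic_zero \<C> (U \<odot> C)"
    and \<epsilon>: "\<epsilon> \<in> Hom \<C> C \<I>" and \<eta>: "\<eta> \<in> Hom \<C> \<I> U" and T: "(\<epsilon>, \<eta>, \<delta>) \<in> Dist \<C>"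
    using assms unfolding complementary_idempotents_def by auto
  have "\<exists>k. k \<in> Hom \<C> A (A \<odot> \<I>) \<and> k \<cdot> runit \<C> A = ident \<C> (A \<odot> \<I>) \<and> runit \<C> A \<cdot> k = ident \<C> A"
    if "A \<in> Ob \<C>" for A
    using runit_iso[OF that] by (elim IsoE) blast
  then obtain k where k: "k A \<in> Hom \<C> A (A \<odot> \<I>)" "k A \<cdot> runit \<C> A = ident \<C> (A \<odot> \<I>)"
    "runit \<C> A \<cdot> k A = ident \<C> A" if "A \<in> Ob \<C>" for A by metis
  have l: "runit \<C> A \<in> Hom \<C> (A \<odot> \<I>) A" if "A \<in> Ob \<C>" for A
    using runit_iso[OF that] by (rule IsoE)
  have \<epsilon>A: "ident \<C> A \<boxtimes> \<epsilon> \<in> Hom \<C> (A \<odot> C) (A \<odot> \<I>)" and \<eta>A: "ident \<C> A \<boxtimes> \<eta> \<in> Hom \<C> (A \<odot> \<I>) (A \<odot> U)"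
    if "A \<in> Ob \<C>" for A using tensor_hom \<epsilon> \<eta> ident_hom that by auto
  let ?e = "\<lambda>A. runit \<C> A \<cdot> (ident \<C> A \<boxtimes> \<epsilon>)" and ?n = "\<lambda>A. (ident \<C> A \<boxtimes> \<eta>) \<cdot> k A"
  have nat: "?e B \<cdot> (f \<boxtimes> ident \<C> C) = f \<cdot> ?e A" if f: "f \<in> Hom \<C> A B" for f A B
  proof -
    have AB: "A \<in> Ob \<C>" "B \<in> Ob \<C>" using HomD[OF f] by auto
    have iA: "ident \<C> A \<in> Hom \<C> A A" and iB: "ident \<C> B \<in> Hom \<C> B B"
      and iI: "ident \<C> \<I> \<in> Hom \<C> \<I> \<I>" and iC: "ident \<C> C \<in> Hom \<C> C C"
      using ident_hom AB unit_ob Ob by auto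
    have If: "f \<boxtimes> ident \<C> \<I> \<in> Hom \<C> (A \<odot> \<I>) (B \<odot> \<I>)" and Cf: "f \<boxtimes> ident \<C> C \<in> Hom \<C> (A \<odot> C) (B \<odot> C)"
      using tensor_hom f iI iC by auto
    have "?e B \<cdot> (f \<boxtimes> ident \<C> C) = runit \<C> B \<cdot> ((ident \<C> B \<boxtimes> \<epsilon>) \<cdot> (f \<boxtimes> ident \<C> C))"
      using comp_assoc[OF Cf \<epsilon>A[OF AB(2)] l[OF AB(2)]] by simp
    also have "(ident \<C> B \<boxtimes> \<epsilon>) \<cdot> (f \<boxtimes> ident \<C> C) = (f \<boxtimes> ident \<C> \<I>) \<cdot> (ident \<C> A \<boxtimes> \<epsilon>)"
      using tensor_comp[OF f iB iC \<epsilon>] tensor_comp[OF iA f \<epsilon> iI] comp_ident[OF \<epsilon>] ident_comp[OF \<epsilon>]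
        comp_ident[OF f] ident_comp[OF f] by simp
    also have "runit \<C> B \<cdot> \<dots> = f \<cdot> ?e A"
      using comp_assoc[OF \<epsilon>A[OF AB(1)] If l[OF AB(2)]] comp_assoc[OF \<epsilon>A[OF AB(1)] l[OF AB(1)] f]
        runit_natural[OF f] by simp
    finally show ?thesis .
  qed
  show ?thesis
  proof (rule that[of ?e ?n], unfold_locales)
    show "\<exists>h. (?e A, ?n A, h) \<in> Dist \<C>" if A: "A \<in> Ob \<C>" for A
      using dist_replace_middle[OF tensor_dist_left[OF T A] \<epsilon>A[OF A] \<eta>A[OF A] l[OF A] k[OF A]] by blast
  qed (use Ob zero nat tensor_functor_right tensor_zero_assoc(2) tensor_zero_susp(2)
      comp_hom[OF \<epsilon>A l] comp_hom[OF k(1) \<eta>A] in auto)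
qed

text \<open>By complementarity \<open>U\<close> kills \<open>C\<close> and \<open>C'\<close> kills
  \<open>U'\<close>, so these are the two objects to which the coincidence argument applies.
  Coincidence of fixed objects is first traded for coincidence of objects killed by the
  complements.\<close>

lemma complementary_hom_zero:
  assumes c: "complementary_idempotents \<C> C U \<epsilon> \<eta> \<delta>" and c': "complementary_idempotents \<C> C' U' \<epsilon>' \<eta>' \<delta>'"
    and \<S>: "\<S> \<in> {left_fixed \<C>, left_killed \<C>, right_fixed \<C>, right_killed \<C>}"
    and eq: "\<S> U = \<S> U' \<or> \<S> C = \<S> C'"
    and X: "X \<in> {C, \<Sigma> C}" and x: "x \<in> Hom \<C> X U'"
  shows "x = zero_arr \<C> X U'"
proof -
  have Ob: "C \<in> Ob \<C>" "U' \<in> Ob \<C>"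
    and zero: "isomorphic_zero \<C> (C \<odot> U)" "isomorphic_zero \<C> (U \<odot> C)"
      "isomorphic_zero \<C> (C' \<odot> U')" "isomorphic_zero \<C> (U' \<odot> C')"
    using c c' unfolding complementary_idempotents_def by auto
  show ?thesis
  proof (cases "\<S> \<in> {left_fixed \<C>, left_killed \<C>}")
    case True
    obtain e n where 1: "idempotent_pair \<C> ((\<odot>) C) ((\<boxtimes>) (ident \<C> C)) ((\<odot>) U) ((\<boxtimes>) (ident \<C> U)) e n"
      using idempotent_pair_left[OF c] .
    obtain e' n' where 2: "idempotent_pair \<C> ((\<odot>) C') ((\<boxtimes>) (ident \<C> C')) ((\<odot>) U') ((\<boxtimes>) (ident \<C> U')) e' n'"
      using idempotent_pair_left[OF c'] .
    note iffs = idempotent_pair.P_fixed_iff[OF 1] idempotent_pair.Q_fixed_iff[OF 1]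
      idempotent_pair.P_fixed_iff[OF 2] idempotent_pair.Q_fixed_iff[OF 2]
    have "(\<forall>A\<in>Ob \<C>. isomorphic_zero \<C> (C \<odot> A) \<longleftrightarrow> isomorphic_zero \<C> (C' \<odot> A)) \<or>
      (\<forall>A\<in>Ob \<C>. isomorphic_zero \<C> (U \<odot> A) \<longleftrightarrow> isomorphic_zero \<C> (U' \<odot> A))"
    proof -
      have "left_fixed \<C> C = left_fixed \<C> C' \<longleftrightarrow> left_killed \<C> U = left_killed \<C> U'"
        and "left_fixed \<C> U = left_fixed \<C> U' \<longleftrightarrow> left_killed \<C> C = left_killed \<C> C'"
        unfolding left_fixed_eq_iff left_killed_eq_iff using iffs by simp_all
      moreover have "\<S> = left_fixed \<C> \<or> \<S> = left_killed \<C>" using True by blast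
      ultimately show ?thesis using eq unfolding left_killed_eq_iff[symmetric] by metis
    qed
    then show ?thesis using hom_zero_of_coincidence[OF 1 2 zero(2) Ob(1) zero(3) Ob(2) _ X x] by blast
  next
    case False
    obtain e n where 1: "idempotent_pair \<C> (\<lambda>A. A \<odot> C) (\<lambda>f. f \<boxtimes> ident \<C> C) (\<lambda>A. A \<odot> U) (\<lambda>f. f \<boxtimes> ident \<C> U) e n"
      using idempotent_pair_right[OF c] .
    obtain e' n' where 2: "idempotent_pair \<C> (\<lambda>A. A \<odot> C') (\<lambda>f. f \<boxtimes> ident \<C> C') (\<lambda>A. A \<odot> U') (\<lambda>f. f \<boxtimes> ident \<C> U') e' n'"
      using idempotent_pair_right[OF c'] .
    note iffs = idempotent_pair.P_fixed_iff[OF 1] idempotent_pair.Q_fixed_iff[OF 1]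
      idempotent_pair.P_fixed_iff[OF 2] idempotent_pair.Q_fixed_iff[OF 2]
    have "(\<forall>A\<in>Ob \<C>. isomorphic_zero \<C> (A \<odot> C) \<longleftrightarrow> isomorphic_zero \<C> (A \<odot> C')) \<or>
      (\<forall>A\<in>Ob \<C>. isomorphic_zero \<C> (A \<odot> U) \<longleftrightarrow> isomorphic_zero \<C> (A \<odot> U'))"
    proof -
      have "right_fixed \<C> C = right_fixed \<C> C' \<longleftrightarrow> right_killed \<C> U = right_killed \<C> U'"
        and "right_fixed \<C> U = right_fixed \<C> U' \<longleftrightarrow> right_killed \<C> C = right_killed \<C> C'"
        unfolding right_fixed_eq_iff right_killed_eq_iff using iffs by simp_all
      moreover have "\<S> = right_fixed \<C> \<or> \<S> = right_killed \<C>" using False \<S> by blast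
      ultimately show ?thesis using eq unfolding right_killed_eq_iff[symmetric] by metis
    qed
    \<comment> \<open>On this side \<open>C\<close> is killed because \<open>C \<odot> U\<close>
      vanishes, and \<open>U'\<close> because \<open>U' \<odot> C'\<close> does; the left-hand case
      used the opposite products.\<close>
    then show ?thesis using hom_zero_of_coincidence[OF 1 2 zero(1) Ob(1) zero(4) Ob(2) _ X x] by blast
  qed
qed

lemma complementary_idempotents_unique:
  assumes c: "complementary_idempotents \<C> C U \<epsilon> \<eta> \<delta>" and c': "complementary_idempotents \<C> C' U' \<epsilon>' \<eta>' \<delta>'"
    and \<S>: "\<S> \<in> {left_fixed \<C>, left_killed \<C>, right_fixed \<C>, right_killed \<C>}"
    and eq: "\<S> U = \<S> U' \<or> \<S> C = \<S> C'"
  shows "\<exists>!(c, u). triangle_iso \<C> (\<epsilon>, \<eta>, \<delta>) (\<epsilon>', \<eta>', \<delta>') (c, ident \<C> \<I>, u)"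
proof -
  have T: "(\<epsilon>, \<eta>, \<delta>) \<in> Dist \<C>" "\<epsilon> \<in> Hom \<C> C \<I>" "\<eta> \<in> Hom \<C> \<I> U" "\<delta> \<in> Hom \<C> U (\<Sigma> C)"
    using c unfolding complementary_idempotents_def by auto
  have T': "(\<epsilon>', \<eta>', \<delta>') \<in> Dist \<C>" "\<epsilon>' \<in> Hom \<C> C' \<I>" "\<eta>' \<in> Hom \<C> \<I> U'" "\<delta>' \<in> Hom \<C> U' (\<Sigma> C')"
    using c' unfolding complementary_idempotents_def by auto
  have eq': "\<S> U' = \<S> U \<or> \<S> C' = \<S> C" using eq by metis
  show ?thesis
  proof (rule dist_comparison_iso[OF T T'])
    fix X Y x
    assume X: "X \<in> {C, \<Sigma> C, C', \<Sigma> C'}" and Y: "Y \<in> {U, U'}" and x: "x \<in> Hom \<C> X Y"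
    consider "X \<in> {C, \<Sigma> C}" "Y = U" | "X \<in> {C, \<Sigma> C}" "Y = U'"
      | "X \<in> {C', \<Sigma> C'}" "Y = U" | "X \<in> {C', \<Sigma> C'}" "Y = U'" using X Y by fast
    then show "x = zero_arr \<C> X Y"
    proof cases
      case 1
      \<comment> \<open>Within one triangle the pair is compared with itself, and the coincidence is
        reflexivity.\<close>
      show ?thesis using x unfolding 1(2) by (rule complementary_hom_zero[OF c c \<S> disjI1[OF refl] 1(1)])
    next
      case 2
      show ?thesis using x unfolding 2(2) by (rule complementary_hom_zero[OF c c' \<S> eq 2(1)])
    next
      case 3
      show ?thesis using x unfolding 3(2) by (rule complementary_hom_zero[OF c' c \<S> eq' 3(1)])
    next
      case 4
      show ?thesis using x unfolding 4(2) by (rule complementary_hom_zero[OF c' c' \<S> disjI1[OF refl] 4(1)])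
    qed
  qed
qed

lemma complementary_idempotents_isomorphic:
  assumes c: "complementary_idempotents \<C> C U \<epsilon> \<eta> \<delta>" and c': "complementary_idempotents \<C> C' U' \<epsilon>' \<eta>' \<delta>'"
    and \<S>: "\<S> \<in> {left_fixed \<C>, left_killed \<C>, right_fixed \<C>, right_killed \<C>}"
    and eq: "\<S> U = \<S> U' \<or> \<S> C = \<S> C'"
  shows "isomorphic \<C> C C'" "isomorphic \<C> U U'"
proof -
  obtain k u where "triangle_iso \<C> (\<epsilon>, \<eta>, \<delta>) (\<epsilon>', \<eta>', \<delta>') (k, ident \<C> \<I>, u)"
    using ex1_implies_ex[OF complementary_idempotents_unique[OF assms]] by auto
  then have "k \<in> Iso \<C> C C'" "u \<in> Iso \<C> U U'"
    using c c' unfolding triangle_iso_def triangle_morphism_def complementary_idempotents_def Iso_def Hom_def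
    by auto
  then show "isomorphic \<C> C C'" "isomorphic \<C> U U'" by (auto intro: isomorphicI)
qed

end

theorem theorem1p6:
  fixes \<A> :: "('o, 'a) tm_category"
  assumes "triangulated_monoidal_category \<A>"
  shows
    "(\<forall>\<S> \<in> {left_fixed \<A>, left_killed \<A>, right_fixed \<A>, right_killed \<A>}.
        (\<forall>U \<eta> U' \<eta>'. unital_idempotent \<A> U \<eta> \<and> unital_idempotent \<A> U' \<eta>' \<and> \<S> U = \<S> U'
            \<longrightarrow> isomorphic \<A> U U') \<and>
        (\<forall>C \<epsilon> C' \<epsilon>'. counital_idempotent \<A> C \<epsilon> \<and> counital_idempotent \<A> C' \<epsilon>' \<and> \<S> C = \<S> C'
            \<longrightarrow> isomorphic \<A> C C') \<and>
        (\<forall>C U \<epsilon> \<eta> \<delta> C' U' \<epsilon>' \<eta>' \<delta>'.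
            complementary_idempotents \<A> C U \<epsilon> \<eta> \<delta> \<and>
            complementary_idempotents \<A> C' U' \<epsilon>' \<eta>' \<delta>' \<and>
            (\<S> U = \<S> U' \<or> \<S> C = \<S> C')
            \<longrightarrow> (\<exists>!(c, u). triangle_iso \<A> (\<epsilon>, \<eta>, \<delta>) (\<epsilon>', \<eta>', \<delta>') (c, ident \<A> \<I>\<^bsub>\<A>\<^esub>, u))))"
proof (intro ballI conjI allI impI; elim conjE)
  interpret triangulated_monoidal_category \<A> by (rule assms)
  fix \<S> assume \<S>: "\<S> \<in> {left_fixed \<A>, left_killed \<A>, right_fixed \<A>, right_killed \<A>}"
  show "isomorphic \<A> U U'"
    if "unital_idempotent \<A> U \<eta>" "unital_idempotent \<A> U' \<eta>'" "\<S> U = \<S> U'" for U \<eta> U' \<eta>'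
    using that complementary_idempotents_isomorphic(2)[OF _ _ \<S>] unfolding unital_idempotent_def by blast
  show "isomorphic \<A> C C'"
    if "counital_idempotent \<A> C \<epsilon>" "counital_idempotent \<A> C' \<epsilon>'" "\<S> C = \<S> C'" for C \<epsilon> C' \<epsilon>'
    using that complementary_idempotents_isomorphic(1)[OF _ _ \<S>] unfolding counital_idempotent_def by blast
  show "\<exists>!(c, u). triangle_iso \<A> (\<epsilon>, \<eta>, \<delta>) (\<epsilon>', \<eta>', \<delta>') (c, ident \<A> \<I>\<^bsub>\<A>\<^esub>, u)"
    if "complementary_idempotents \<A> C U \<epsilon> \<eta> \<delta>" "complementary_idempotents \<A> C' U' \<epsilon>' \<eta>' \<delta>'"
      "\<S> U = \<S> U' \<or> \<S> C = \<S> C'" for C U \<epsilon> \<eta> \<delta> C' U' \<epsilon>' \<eta>' \<delta>'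
    using complementary_idempotents_unique[OF that(1,2) \<S> that(3)] .
qed

end
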